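(* Let $A$ be a Lie algebroid and let $(\pi,\pi')$ be a Hamiltonian pair on $A$. Then $\mathbf N(\pi,\pi')$ is a Nijenhuis relation.
   Context: $[~,~]$ denotes the Lie algebroid bracket on $\Gamma A$, and also the Schouten--Nijenhuis bracket on $\Gamma(\wedge^\bullet A)$. A bivector $\pi\in\Gamma(\wedge^2A)$ is identified with the map $\pi:A^*\to A$, $\pi\xi=i_\xi\pi$, i.e. $\langle\eta,\pi\xi\rangle=\pi(\xi,\eta)$, and with the induced map on sections. It is a Poisson structure if $[\pi,\pi]=0$. A Hamiltonian pair (bi-Hamiltonian structure) is a pair $(\pi,\pi')$ of Poisson structures such that $\pi+\pi'$ is also a Poisson structure, equivalently $[\pi,\pi']=0$. Relations are taken at the level of sections. For a relation $\mathbf N\subset\Gamma A\times\Gamma A$, the dual relation is $\mathbf N^*=\{(\beta,\alpha)\in\Gamma(A^* )\times\Gamma(A^* )\mid\langle\alpha,u\rangle=\langle\beta,v\rangle\ \forall(u,v)\in\mathbf N\}$. $\mathbf N$ is a Nijenhuis relation if its torsion vanishes, i.e. $\langle\alpha,[v_1,v_2]\rangle-\langle\alpha',[v_1,u_2]+[u_1,v_2]\rangle+\langle\alpha'',[u_1,u_2]\rangle=0$ for all $(u_1,v_1),(u_2,v_2)\in\mathbf N$ and all $(\alpha,\alpha'),(\alpha',\alpha'')\in\mathbf N^*$. For bivectors $\pi,\pi'$, $\mathbf N(\pi,\pi')=\{(\pi'\xi,\pi\xi)\mid\xi\in\Gamma(A^* )\}$. *)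

theory Defs
  imports "HOL-Analysis.Analysis"
begin

section \<open>Smooth manifolds\<close>

text \<open>\<open>f\<close> is \<open>C\<^sup>k\<close> on the open set \<open>S\<close>. The recursion is on directional derivatives, which for
  a finite-dimensional domain is the usual notion.\<close>

primrec Ck_on :: "nat \<Rightarrow> 'e::real_normed_vector set \<Rightarrow> ('e \<Rightarrow> 'f::real_normed_vector) \<Rightarrow> bool" where
  "Ck_on 0 S f \<longleftrightarrow> continuous_on S f"
| "Ck_on (Suc k) S f \<longleftrightarrow> (\<forall>x\<in>S. f differentiable (at x)) \<and>
     (\<forall>v. Ck_on k S (\<lambda>x. frechet_derivative f (at x) v))"

definition smooth_on :: "'e::real_normed_vector set \<Rightarrow> ('e \<Rightarrow> 'f::real_normed_vector) \<Rightarrow> bool" where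
  "smooth_on S f \<longleftrightarrow> (\<forall>k. Ck_on k S f)"

record ('m, 'e) mfd =
  charts :: "('m set \<times> ('m \<Rightarrow> 'e)) set"

text \<open>The manifold is the whole type \<open>'m\<close>. The model space is an arbitrary finite-dimensional inner
  product space \<open>'e\<close>; unlike \<open>euclidean_space\<close>, this sort admits the zero space, so that manifolds of
  dimension 0 (and hence Lie algebras, as Lie algebroids over a point) are included.\<close>

definition smooth_manifold ::
  "('m::{t2_space,second_countable_topology}, 'e::real_inner, 'z) mfd_scheme \<Rightarrow> bool" where
  "smooth_manifold M \<longleftrightarrow>
     (\<exists>B::'e set. finite B \<and> span B = UNIV) \<and>
     (\<Union>(U, \<phi>)\<in>charts M. U) = UNIV \<and>
     (\<forall>(U, \<phi>)\<in>charts M. open U \<and> open (\<phi> ` U) \<and> homeomorphism U (\<phi> ` U) \<phi> (inv_into U \<phi>)) \<and>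
     (\<forall>(U, \<phi>)\<in>charts M. \<forall>(V, \<psi>)\<in>charts M. smooth_on (\<phi> ` (U \<inter> V)) (\<psi> \<circ> inv_into U \<phi>))"

definition smooth_fun_on ::
  "('m, 'e::real_inner, 'z) mfd_scheme \<Rightarrow> 'm set \<Rightarrow> ('m \<Rightarrow> real) \<Rightarrow> bool" where
  "smooth_fun_on M W f \<longleftrightarrow> (\<forall>(U, \<phi>)\<in>charts M. smooth_on (\<phi> ` (U \<inter> W)) (f \<circ> inv_into U \<phi>))"

definition smooth_functions :: "('m, 'e::real_inner, 'z) mfd_scheme \<Rightarrow> ('m \<Rightarrow> real) set" where
  "smooth_functions M = {f. smooth_fun_on M UNIV f}"

text \<open>Tangent vectors at \<open>x\<close> are the derivations of the algebra of smooth functions at \<open>x\<close>.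
  The last conjunct only normalises the values at non-smooth functions.\<close>

definition tangent_space ::
  "('m, 'e::real_inner, 'z) mfd_scheme \<Rightarrow> 'm \<Rightarrow> (('m \<Rightarrow> real) \<Rightarrow> real) set" where
  "tangent_space M x = {D.
     (\<forall>f\<in>smooth_functions M. \<forall>g\<in>smooth_functions M. \<forall>a b.
        D (\<lambda>y. a * f y + b * g y) = a * D f + b * D g) \<and>
     (\<forall>f\<in>smooth_functions M. \<forall>g\<in>smooth_functions M.
        D (\<lambda>y. f y * g y) = D f * g x + f x * D g) \<and>
     (\<forall>f. f \<notin> smooth_functions M \<longrightarrow> D f = 0)}"


section \<open>Vector bundles\<close>

text \<open>The fibre over \<open>x\<close> is a subspace of an ambient real vector space \<open>'v\<close>, which only serves as a
  container (every family of vector spaces embeds fibrewise into its direct sum). The bundle structure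
  is given by local frames \<open>(U, e)\<close>, that is, local trivialisations, with smooth transition matrices.\<close>

record ('m, 'e, 'v) vbundle = "('m, 'e) mfd" +
  fibre :: "'m \<Rightarrow> 'v set"
  rank :: nat
  frames :: "('m set \<times> (nat \<Rightarrow> 'm \<Rightarrow> 'v)) set"

definition coframe ::
  "('m, 'e, 'v::real_vector, 'z) vbundle_scheme \<Rightarrow> (nat \<Rightarrow> 'm \<Rightarrow> 'v) \<Rightarrow> 'm \<Rightarrow> nat \<Rightarrow> 'v \<Rightarrow> real" where
  "coframe A e x i = (\<lambda>v. representation ((\<lambda>j. e j x) ` {..<rank A}) v (e i x))"

definition vector_bundle ::
  "('m::{t2_space,second_countable_topology}, 'e::real_inner, 'v::real_vector, 'z) vbundle_scheme
     \<Rightarrow> bool" where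
  "vector_bundle A \<longleftrightarrow>
     smooth_manifold A \<and>
     (\<Union>(U, e)\<in>frames A. U) = UNIV \<and>
     (\<forall>(U, e)\<in>frames A. open U \<and>
        (\<forall>x\<in>U. inj_on (\<lambda>i. e i x) {..<rank A} \<and> independent ((\<lambda>i. e i x) ` {..<rank A}) \<and>
               span ((\<lambda>i. e i x) ` {..<rank A}) = fibre A x)) \<and>
     (\<forall>(U, e)\<in>frames A. \<forall>(U', e')\<in>frames A. \<forall>i<rank A. \<forall>j<rank A.
        smooth_fun_on A (U \<inter> U') (\<lambda>x. coframe A e x i (e' j x)))"

definition sections ::
  "('m, 'e::real_inner, 'v::real_vector, 'z) vbundle_scheme \<Rightarrow> ('m \<Rightarrow> 'v) set" where
  "sections A = {X. (\<forall>x. X x \<in> fibre A x) \<and>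
     (\<forall>(U, e)\<in>frames A. \<forall>i<rank A. smooth_fun_on A U (\<lambda>x. coframe A e x i (X x)))}"

text \<open>A linear form on the subspace \<open>V\<close> is represented by its extension by 0 outside of \<open>V\<close> (not a
  linear extension), so that equality of forms on \<open>V\<close> is equality of functions.\<close>

definition dual_space :: "'v::real_vector set \<Rightarrow> ('v \<Rightarrow> real) set" where
  "dual_space V = {\<xi>. (\<forall>u\<in>V. \<forall>v\<in>V. \<forall>a b. \<xi> (a *\<^sub>R u + b *\<^sub>R v) = a * \<xi> u + b * \<xi> v) \<and>
                      (\<forall>v. v \<notin> V \<longrightarrow> \<xi> v = 0)}"

definition dual_sections ::
  "('m, 'e::real_inner, 'v::real_vector, 'z) vbundle_scheme \<Rightarrow> ('m \<Rightarrow> 'v \<Rightarrow> real) set" where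
  "dual_sections A = {\<xi>. (\<forall>x. \<xi> x \<in> dual_space (fibre A x)) \<and>
     (\<forall>(U, e)\<in>frames A. \<forall>i<rank A. smooth_fun_on A U (\<lambda>x. \<xi> x (e i x)))}"

definition pairing :: "('m \<Rightarrow> 'v \<Rightarrow> real) \<Rightarrow> ('m \<Rightarrow> 'v) \<Rightarrow> 'm \<Rightarrow> real" where
  "pairing \<xi> X = (\<lambda>x. \<xi> x (X x))"


section \<open>Multivectors\<close>

text \<open>\<open>\<Lambda>\<^sup>pV\<close> is realised as the space of alternating \<open>p\<close>-linear forms on \<open>V\<^sup>*\<close>, the arguments being
  collected in a list. Values at lists that are not lists of \<open>p\<close> elements of \<open>V\<^sup>*\<close> are normalised to 0.\<close>

definition ext_power :: "'v::real_vector set \<Rightarrow> nat \<Rightarrow> (('v \<Rightarrow> real) list \<Rightarrow> real) set" where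
  "ext_power V p = {P.
     (\<forall>xs. \<not> (length xs = p \<and> set xs \<subseteq> dual_space V) \<longrightarrow> P xs = 0) \<and>
     (\<forall>xs ys. \<forall>\<xi>\<in>dual_space V. \<forall>\<eta>\<in>dual_space V. \<forall>a b.
        set xs \<subseteq> dual_space V \<longrightarrow> set ys \<subseteq> dual_space V \<longrightarrow>
        P (xs @ (\<lambda>v. a * \<xi> v + b * \<eta> v) # ys) = a * P (xs @ \<xi> # ys) + b * P (xs @ \<eta> # ys)) \<and>
     (\<forall>xs. \<not> distinct xs \<longrightarrow> P xs = 0)}"

type_synonym ('m, 'v) mvfield = "'m \<Rightarrow> ('v \<Rightarrow> real) list \<Rightarrow> real"

definition mv_sections ::
  "('m, 'e::real_inner, 'v::real_vector, 'z) vbundle_scheme \<Rightarrow> nat \<Rightarrow> ('m, 'v) mvfield set" where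
  "mv_sections A p = {P. (\<forall>x. P x \<in> ext_power (fibre A x) p) \<and>
     (\<forall>(U, e)\<in>frames A. \<forall>is. length is = p \<longrightarrow> set is \<subseteq> {..<rank A} \<longrightarrow>
        smooth_fun_on A U (\<lambda>x. P x (map (coframe A e x) is)))}"

text \<open>The sum over shuffles
  \<open>(P \<and> Q)(\<xi>\<^sub>1, \<dots>, \<xi>\<^sub>n) = \<Sum> \<plusminus> P(\<xi>\<^sub>I) Q(\<xi>\<^sub>J)\<close>, with \<open>J\<close> the complement of \<open>I\<close> and the sign of the
  shuffle \<open>(I, J)\<close>. For \<open>P\<close> of degree \<open>p\<close> only the terms with \<open>card I = p\<close> contribute. In particular
  \<open>(X \<and> Y)(\<xi>, \<eta>) = \<langle>\<xi>,X\<rangle>\<langle>\<eta>,Y\<rangle> - \<langle>\<xi>,Y\<rangle>\<langle>\<eta>,X\<rangle>\<close>.\<close>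

definition shuffle_sign :: "nat \<Rightarrow> nat set \<Rightarrow> real" where
  "shuffle_sign n I = (-1) ^ card {(i, j). i \<in> I \<and> j \<in> {..<n} - I \<and> j < i}"

definition wedge :: "('m, 'v) mvfield \<Rightarrow> ('m, 'v) mvfield \<Rightarrow> ('m, 'v) mvfield" where
  "wedge P Q = (\<lambda>x xs. \<Sum>I\<in>Pow {..<length xs}.
      shuffle_sign (length xs) I * P x (nths xs I) * Q x (nths xs (- I)))"

definition mv_zero :: "('m, 'v) mvfield" where
  "mv_zero = (\<lambda>x xs. 0)"

definition mv_add :: "('m, 'v) mvfield \<Rightarrow> ('m, 'v) mvfield \<Rightarrow> ('m, 'v) mvfield" where
  "mv_add P Q = (\<lambda>x xs. P x xs + Q x xs)"

definition mv_scale :: "real \<Rightarrow> ('m, 'v) mvfield \<Rightarrow> ('m, 'v) mvfield" where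
  "mv_scale c P = (\<lambda>x xs. c * P x xs)"

text \<open>The identifications of functions with sections of \<open>\<Lambda>\<^sup>0A\<close> and of sections of \<open>A\<close> with sections
  of \<open>\<Lambda>\<^sup>1A\<close>.\<close>

definition mv_of_fun :: "('m \<Rightarrow> real) \<Rightarrow> ('m, 'v) mvfield" where
  "mv_of_fun f = (\<lambda>x xs. if xs = [] then f x else 0)"

definition mv_of_section ::
  "('m, 'e, 'v::real_vector, 'z) vbundle_scheme \<Rightarrow> ('m \<Rightarrow> 'v) \<Rightarrow> ('m, 'v) mvfield" where
  "mv_of_section A X =
     (\<lambda>x xs. if length xs = 1 \<and> set xs \<subseteq> dual_space (fibre A x) then hd xs (X x) else 0)"

text \<open>The map \<open>\<pi> : \<Gamma>(A\<^sup>*) \<rightarrow> \<Gamma>A\<close> induced by a bivector: \<open>\<langle>\<eta>, \<pi>\<xi>\<rangle> = \<pi>(\<xi>, \<eta>)\<close>.\<close>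

definition sharp ::
  "('m, 'e, 'v::real_vector, 'z) vbundle_scheme \<Rightarrow> ('m, 'v) mvfield \<Rightarrow>
     ('m \<Rightarrow> 'v \<Rightarrow> real) \<Rightarrow> 'm \<Rightarrow> 'v" where
  "sharp A \<pi> \<xi> =
     (\<lambda>x. THE v. v \<in> fibre A x \<and> (\<forall>\<eta>\<in>dual_space (fibre A x). \<eta> v = \<pi> x [\<xi> x, \<eta>]))"


section \<open>Lie algebroids\<close>

record ('m, 'e, 'v) algebroid = "('m, 'e, 'v) vbundle" +
  anchor :: "'m \<Rightarrow> 'v \<Rightarrow> ('m \<Rightarrow> real) \<Rightarrow> real"
  bracket :: "('m \<Rightarrow> 'v) \<Rightarrow> ('m \<Rightarrow> 'v) \<Rightarrow> 'm \<Rightarrow> 'v"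

definition act ::
  "('m, 'e, 'v, 'z) algebroid_scheme \<Rightarrow> ('m \<Rightarrow> 'v) \<Rightarrow> ('m \<Rightarrow> real) \<Rightarrow> 'm \<Rightarrow> real" where
  "act A X f = (\<lambda>x. anchor A x (X x) f)"

definition bundle_anchor ::
  "('m, 'e::real_inner, 'v::real_vector, 'z) algebroid_scheme \<Rightarrow> bool" where
  "bundle_anchor A \<longleftrightarrow>
     (\<forall>x. \<forall>v\<in>fibre A x. anchor A x v \<in> tangent_space A x) \<and>
     (\<forall>x. \<forall>u\<in>fibre A x. \<forall>v\<in>fibre A x. \<forall>a b f.
        anchor A x (a *\<^sub>R u + b *\<^sub>R v) f = a * anchor A x u f + b * anchor A x v f) \<and>
     (\<forall>X\<in>sections A. \<forall>f\<in>smooth_functions A. act A X f \<in> smooth_functions A)"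

definition lie_bracket_on_sections ::
  "('m, 'e::real_inner, 'v::real_vector, 'z) algebroid_scheme \<Rightarrow> bool" where
  "lie_bracket_on_sections A \<longleftrightarrow>
     (\<forall>X\<in>sections A. \<forall>Y\<in>sections A. bracket A X Y \<in> sections A) \<and>
     (\<forall>X\<in>sections A. \<forall>Y\<in>sections A. \<forall>Z\<in>sections A. \<forall>a b.
        bracket A X (\<lambda>x. a *\<^sub>R Y x + b *\<^sub>R Z x) =
          (\<lambda>x. a *\<^sub>R bracket A X Y x + b *\<^sub>R bracket A X Z x)) \<and>
     (\<forall>X\<in>sections A. \<forall>Y\<in>sections A. bracket A X Y = (\<lambda>x. - bracket A Y X x)) \<and>
     (\<forall>X\<in>sections A. \<forall>Y\<in>sections A. \<forall>Z\<in>sections A. \<forall>x.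
        bracket A X (bracket A Y Z) x + bracket A Y (bracket A Z X) x
          + bracket A Z (bracket A X Y) x = 0)"

definition lie_algebroid ::
  "('m::{t2_space,second_countable_topology}, 'e::real_inner, 'v::real_vector, 'z) algebroid_scheme
     \<Rightarrow> bool" where
  "lie_algebroid A \<longleftrightarrow>
     vector_bundle A \<and> bundle_anchor A \<and> lie_bracket_on_sections A \<and>
     (\<forall>X\<in>sections A. \<forall>Y\<in>sections A. \<forall>f\<in>smooth_functions A.
        bracket A X (\<lambda>x. f x *\<^sub>R Y x) = (\<lambda>x. f x *\<^sub>R bracket A X Y x + act A X f x *\<^sub>R Y x)) \<and>
     (\<forall>X\<in>sections A. \<forall>Y\<in>sections A. \<forall>f\<in>smooth_functions A. \<forall>x.
        act A (bracket A X Y) f x = act A X (act A Y f) x - act A Y (act A X f) x)"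

text \<open>\<open>S\<close> is the Schouten--Nijenhuis bracket on \<open>\<Gamma>(\<Lambda>\<^sup>\<bullet>A)\<close>: the unique bilinear operation of degree
  \<open>-1\<close> that extends the Lie bracket of sections and the action of sections on functions, with
  \<open>[P, Q] = -(-1)\<^bsup>(p-1)(q-1)\<^esup> [Q, P]\<close> and
  \<open>[P, Q \<and> R] = [P, Q] \<and> R + (-1)\<^bsup>(p-1)q\<^esup> Q \<and> [P, R]\<close>.
  The exponents below have \<open>p + 1\<close> for \<open>p - 1\<close>, to avoid truncated subtraction. The graded Jacobi
  identity is a consequence. \<open>S\<close> is only constrained on homogeneous sections.\<close>

definition schouten_bracket ::
  "('m, 'e::real_inner, 'v::real_vector, 'z) algebroid_scheme \<Rightarrow>
     (('m, 'v) mvfield \<Rightarrow> ('m, 'v) mvfield \<Rightarrow> ('m, 'v) mvfield) \<Rightarrow> bool" where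
  "schouten_bracket A S \<longleftrightarrow>
     (\<forall>p q. \<forall>P\<in>mv_sections A p. \<forall>Q\<in>mv_sections A q.
        if p + q = 0 then S P Q = mv_zero else S P Q \<in> mv_sections A (p + q - 1)) \<and>
     (\<forall>p q. \<forall>P\<in>mv_sections A p. \<forall>Q\<in>mv_sections A q. \<forall>R\<in>mv_sections A q. \<forall>a b.
        S P (mv_add (mv_scale a Q) (mv_scale b R)) =
          mv_add (mv_scale a (S P Q)) (mv_scale b (S P R))) \<and>
     (\<forall>p q. \<forall>P\<in>mv_sections A p. \<forall>Q\<in>mv_sections A q.
        S P Q = mv_scale (- ((-1) ^ ((p + 1) * (q + 1)))) (S Q P)) \<and>
     (\<forall>p q r. \<forall>P\<in>mv_sections A p. \<forall>Q\<in>mv_sections A q. \<forall>R\<in>mv_sections A r.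
        S P (wedge Q R) =
          mv_add (wedge (S P Q) R) (mv_scale ((-1) ^ ((p + 1) * q)) (wedge Q (S P R)))) \<and>
     (\<forall>X\<in>sections A. \<forall>f\<in>smooth_functions A.
        S (mv_of_section A X) (mv_of_fun f) = mv_of_fun (act A X f)) \<and>
     (\<forall>X\<in>sections A. \<forall>Y\<in>sections A.
        S (mv_of_section A X) (mv_of_section A Y) = mv_of_section A (bracket A X Y))"


section \<open>Hamiltonian pairs and Nijenhuis relations\<close>

text \<open>In the next two definitions \<open>S\<close> stands for the Schouten--Nijenhuis bracket of \<open>A\<close>.\<close>

definition poisson_structure ::
  "('m, 'e::real_inner, 'v::real_vector, 'z) algebroid_scheme \<Rightarrow>
     (('m, 'v) mvfield \<Rightarrow> ('m, 'v) mvfield \<Rightarrow> ('m, 'v) mvfield) \<Rightarrow> ('m, 'v) mvfield \<Rightarrow> bool" where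
  "poisson_structure A S \<pi> \<longleftrightarrow> \<pi> \<in> mv_sections A 2 \<and> S \<pi> \<pi> = mv_zero"

definition hamiltonian_pair ::
  "('m, 'e::real_inner, 'v::real_vector, 'z) algebroid_scheme \<Rightarrow>
     (('m, 'v) mvfield \<Rightarrow> ('m, 'v) mvfield \<Rightarrow> ('m, 'v) mvfield) \<Rightarrow>
     ('m, 'v) mvfield \<Rightarrow> ('m, 'v) mvfield \<Rightarrow> bool" where
  "hamiltonian_pair A S \<pi> \<pi>' \<longleftrightarrow>
     poisson_structure A S \<pi> \<and> poisson_structure A S \<pi>' \<and> poisson_structure A S (mv_add \<pi> \<pi>')"

definition dual_relation ::
  "('m, 'e::real_inner, 'v::real_vector, 'z) vbundle_scheme \<Rightarrow> (('m \<Rightarrow> 'v) \<times> ('m \<Rightarrow> 'v)) set \<Rightarrow>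
     (('m \<Rightarrow> 'v \<Rightarrow> real) \<times> ('m \<Rightarrow> 'v \<Rightarrow> real)) set" where
  "dual_relation A N = {(\<beta>, \<alpha>). \<beta> \<in> dual_sections A \<and> \<alpha> \<in> dual_sections A \<and>
     (\<forall>(u, v)\<in>N. pairing \<alpha> u = pairing \<beta> v)}"

definition nijenhuis_relation ::
  "('m, 'e::real_inner, 'v::real_vector, 'z) algebroid_scheme \<Rightarrow>
     (('m \<Rightarrow> 'v) \<times> ('m \<Rightarrow> 'v)) set \<Rightarrow> bool" where
  "nijenhuis_relation A N \<longleftrightarrow>
     N \<subseteq> sections A \<times> sections A \<and>
     (\<forall>(u1, v1)\<in>N. \<forall>(u2, v2)\<in>N. \<forall>\<alpha> \<alpha>' \<alpha>''.
        (\<alpha>, \<alpha>') \<in> dual_relation A N \<longrightarrow> (\<alpha>', \<alpha>'') \<in> dual_relation A N \<longrightarrow>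
        (\<forall>x. pairing \<alpha> (bracket A v1 v2) x
           - pairing \<alpha>' (\<lambda>y. bracket A v1 u2 y + bracket A u1 v2 y) x
           + pairing \<alpha>'' (bracket A u1 u2) x = 0))"

definition pair_relation ::
  "('m, 'e::real_inner, 'v::real_vector, 'z) vbundle_scheme \<Rightarrow>
     ('m, 'v) mvfield \<Rightarrow> ('m, 'v) mvfield \<Rightarrow> (('m \<Rightarrow> 'v) \<times> ('m \<Rightarrow> 'v)) set" where
  "pair_relation A \<pi> \<pi>' = {(sharp A \<pi>' \<xi>, sharp A \<pi> \<xi>) | \<xi>. \<xi> \<in> dual_sections A}"

end

theory Submission
  imports Defs
begin

text \<open>Evaluated on sections \<open>\<xi>, \<eta>, \<zeta>\<close> of \<open>A\<^sup>*\<close>, the bracket \<open>[\<pi>, \<pi>]\<close> is twice the cyclic sum of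
  \<open>\<langle>\<xi>,[\<pi>\<eta>, \<pi>\<zeta>]\<rangle> + (\<pi>\<xi>)\<langle>\<eta>,\<pi>\<zeta>\<rangle>\<close>. For \<open>(\<alpha>, \<alpha>'), (\<alpha>', \<alpha>'')\<close> in the dual relation one has
  \<open>\<pi>\<alpha> = \<pi>'\<alpha>'\<close> and \<open>\<pi>\<alpha>' = \<pi>'\<alpha>''\<close>, so that in
  \<open>\<onehalf>[\<pi>, \<pi>](\<xi>, \<eta>, \<alpha>) - [\<pi>, \<pi>'](\<xi>, \<eta>, \<alpha>') + \<onehalf>[\<pi>', \<pi>'](\<xi>, \<eta>, \<alpha>'') = 0\<close>
  all terms except those of the torsion cancel.

  The formula for \<open>[\<pi>, \<pi>]\<close> is a computation with the Leibniz rule when \<open>\<pi>\<close> is a sum of products \<open>X \<and> Y\<close> of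
  global sections. In general bump functions give, for every point \<open>x\<close>, a function \<open>g\<close> with \<open>g x \<noteq> 0\<close>
  for which \<open>g \<pi>\<close> is such a sum. Under \<open>\<pi> \<mapsto> g \<pi>\<close> both sides of the formula are multiplied by \<open>g\<^sup>2\<close> and
  acquire the same terms in \<open>dg\<close>, so the formula for \<open>\<pi>\<close> at \<open>x\<close> follows from the one for \<open>g \<pi>\<close>.\<close>


section \<open>Calculus of smooth functions\<close>

text \<open>The Schouten bracket \<open>S\<close> is given only by axioms on global sections, with
  no locality assumed, so its value at a point cannot simply be computed in a local frame. Bump
  functions keep all objects global, and the Leibniz rule for \<open>S\<close> moves the factor
  \<open>g\<close> out of the bracket; this replaces localisation, at the price of derivatives of
  \<open>g\<close>. They enter through [P, g], whose value on \<xi> is the derivative of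
  \<open>g\<close> along P\<xi>. That auxiliary formula is itself proved by multiplication with a
  bump function, and there no derivative of the factor survives because [f, g] = 0 for functions.

  For sums of products the formula has to be proved for mixed brackets [P, Q], since expanding a sum
  produces them. For general bivectors only the diagonal [P, P] is treated: the mixed identity
  follows by polarisation from \<pi>, \<pi>' and \<pi> + \<pi>', which is how a Hamiltonian pair is
  given.\<close>

lemma Ck_on_cong:
  assumes "open S" "\<And>x. x \<in> S \<Longrightarrow> f x = g x"
  shows "Ck_on k S f \<longleftrightarrow> Ck_on k S g"
proof -
  have "Ck_on k S f \<Longrightarrow> Ck_on k S g" if "\<And>x. x \<in> S \<Longrightarrow> f x = g x" for f g
    using that
  proof (induction k arbitrary: f g)
    case 0
    then show ?case
      using continuous_on_cong[of S S f g] by simp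
  next
    case (Suc k)
    have "g differentiable (at x)" if "x \<in> S" for x
      using Suc.prems that assms(1)
      by (metis Ck_on.simps(2) differentiable_def has_derivative_transform_within_open)
    moreover have "Ck_on k S (\<lambda>x. frechet_derivative g (at x) v)" for v
    proof (rule Suc.IH)
      show "Ck_on k S (\<lambda>x. frechet_derivative f (at x) v)"
        using Suc.prems by simp
      show "frechet_derivative f (at x) v = frechet_derivative g (at x) v" if "x \<in> S" for x
        using frechet_derivative_transform_within_open[of f x S g] Suc.prems that assms(1) by auto
    qed
    ultimately show ?case
      by simp
  qed
  then show ?thesis
    using assms(2) by metis
qed

lemma Ck_on_SucD: "Ck_on (Suc k) S f \<Longrightarrow> Ck_on k S f"
proof (induction k arbitrary: f)
  case 0
  then show ?case
    by (simp add: continuous_at_imp_continuous_on differentiable_imp_continuous_within)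
next
  case (Suc k)
  then show ?case
    by (metis Ck_on.simps(2))
qed

lemma Ck_on_subset: "Ck_on k S f \<Longrightarrow> T \<subseteq> S \<Longrightarrow> Ck_on k T f"
  by (induction k arbitrary: f) (auto intro: continuous_on_subset)

lemma Ck_on_Union:
  assumes "\<And>S. S \<in> C \<Longrightarrow> open S" "\<And>S. S \<in> C \<Longrightarrow> Ck_on k S f"
  shows "Ck_on k (\<Union>C) f"
  using assms(2)
proof (induction k arbitrary: f)
  case 0
  then show ?case
    using assms(1) continuous_on_open_Union[of C f] by simp
next
  case (Suc k)
  then show ?case
    by (metis Ck_on.simps(2) UnionE)
qed

lemma Ck_on_const: "Ck_on k S (\<lambda>x. c)"
  by (induction k arbitrary: c) auto

text \<open>By uniqueness of derivatives any pointwise formula for the derivative may replace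
  \<open>frechet_derivative\<close>; openness of \<open>S\<close> allows the exchange inside the
  recursive condition.\<close>

lemma Ck_on_SucI:
  assumes "open S" "\<And>x. x \<in> S \<Longrightarrow> (f has_derivative f' x) (at x)"
    "\<And>v. Ck_on k S (\<lambda>x. f' x v)"
  shows "Ck_on (Suc k) S f"
proof -
  have "Ck_on k S (\<lambda>x. frechet_derivative f (at x) v)" for v
  proof -
    have "frechet_derivative f (at x) v = f' x v" if "x \<in> S" for x
      using assms(2)[OF that] frechet_derivative_at[of f "f' x" x] by metis
    then show ?thesis
      using Ck_on_cong[OF assms(1), of "\<lambda>x. frechet_derivative f (at x) v" "\<lambda>x. f' x v"]
        assms(3) by blast
  qed
  then show ?thesis
    using assms(2) by (auto simp: differentiable_def)
qed

lemma Ck_on_SucE: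
  assumes "Ck_on (Suc k) S f" "x \<in> S"
  shows "(f has_derivative frechet_derivative f (at x)) (at x)"
  using assms frechet_derivative_works by auto

lemma Ck_on_add:
  assumes "open S" "Ck_on k S f" "Ck_on k S g"
  shows "Ck_on k S (\<lambda>x. f x + g x)"
  using assms(2,3)
proof (induction k arbitrary: f g)
  case 0
  then show ?case
    by (auto intro: continuous_on_add)
next
  case (Suc k)
  show ?case
  proof (rule Ck_on_SucI[OF assms(1)])
    show "((\<lambda>x. f x + g x) has_derivative
        (\<lambda>v. frechet_derivative f (at x) v + frechet_derivative g (at x) v)) (at x)"
      if "x \<in> S" for x
      using Suc.prems that by (intro has_derivative_add Ck_on_SucE)
    show "Ck_on k S (\<lambda>x. frechet_derivative f (at x) v + frechet_derivative g (at x) v)" for v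
      using Suc by simp
  qed
qed

lemma Ck_on_bilinear:
  assumes "bounded_bilinear p" "open S" "Ck_on k S f" "Ck_on k S g"
  shows "Ck_on k S (\<lambda>x. p (f x) (g x))"
  using assms(3,4)
proof (induction k arbitrary: f g)
  case 0
  then show ?case
    using bounded_bilinear.continuous_on[OF assms(1)] by auto
next
  case (Suc k)
  show ?case
  proof (rule Ck_on_SucI[OF assms(2)])
    show "((\<lambda>x. p (f x) (g x)) has_derivative
        (\<lambda>v. p (f x) (frechet_derivative g (at x) v) + p (frechet_derivative f (at x) v) (g x))) (at x)"
      if "x \<in> S" for x
      using Suc.prems that by (intro bounded_bilinear.FDERIV[OF assms(1)] Ck_on_SucE)
    have "Ck_on k S f" "Ck_on k S g"
      using Suc.prems by (simp_all only: Ck_on_SucD)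
    then show "Ck_on k S (\<lambda>x. p (f x) (frechet_derivative g (at x) v)
        + p (frechet_derivative f (at x) v) (g x))" for v
      using Suc.prems by (intro Ck_on_add[OF assms(2)] Suc.IH) auto
  qed
qed

text \<open>The factors \<open>t^-n\<close> make the family closed under differentiation.\<close>

definition flat_exp :: "nat \<Rightarrow> real \<Rightarrow> real" where
  "flat_exp n t = (if t > 0 then exp (- (1 / t)) / t ^ n else 0)"

text \<open>With s = 1/t the claim becomes s^n / exp s -> 0 as s tends to infinity.\<close>

lemma flat_exp_tendsto_0: "(flat_exp n \<longlongrightarrow> 0) (at_right 0)"
proof -
  have "((\<lambda>t. inverse t ^ n / exp (inverse t)) \<longlongrightarrow> (0::real)) (at_right 0)"
    using filterlim_compose[OF tendsto_power_div_exp_0 filterlim_inverse_at_top_right] by blast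
  moreover have "\<forall>\<^sub>F t in at_right 0. inverse t ^ n / exp (inverse t) = flat_exp n t"
    by (auto simp: flat_exp_def eventually_at_right_field exp_minus field_simps intro!: exI[of _ 1])
  ultimately show ?thesis
    by (simp cong: tendsto_cong)
qed

lemma has_real_derivative_flat_exp:
  "(flat_exp n has_real_derivative flat_exp (n + 2) t - real n * flat_exp (n + 1) t) (at t)"
proof -
  consider "t < 0" | "t = 0" | "t > 0"
    by linarith
  then show ?thesis
  proof cases
    case 1
    have "((\<lambda>t. 0) has_real_derivative 0) (at t)"
      by simp
    then have "(flat_exp n has_real_derivative 0) (at t)"
      by (rule has_field_derivative_transform_within_open[where S = "{..<0}"])
        (use 1 in \<open>auto simp: flat_exp_def\<close>)
    then show ?thesis
      using 1 by (simp add: flat_exp_def)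
  next
    case 2
    \<comment> \<open>The difference quotient at 0 vanishes on the left and equals
      \<open>flat_exp (Suc n)\<close> on the right, so the limit already known gives the derivative
      0.\<close>
    have "((\<lambda>h. flat_exp n h / h) \<longlongrightarrow> 0) (at_left 0)"
      by (rule tendsto_eventually) (auto simp: flat_exp_def eventually_at_left_field intro!: exI[of _ "-1"])
    moreover have "((\<lambda>h. flat_exp n h / h) \<longlongrightarrow> 0) (at_right 0)"
    proof -
      have "\<forall>\<^sub>F h in at_right 0. flat_exp (Suc n) h = flat_exp n h / h"
        by (auto simp: flat_exp_def eventually_at_right_field field_simps intro!: exI[of _ 1])
      then show ?thesis
        using flat_exp_tendsto_0[of "Suc n"] by (simp cong: tendsto_cong)
    qed
    ultimately have "((\<lambda>h. flat_exp n h / h) \<longlongrightarrow> 0) (at 0)"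
      by (simp add: filterlim_at_split)
    then show ?thesis
      using 2 by (simp add: flat_exp_def has_field_derivative_iff)
  next
    case 3
    have "((\<lambda>t. exp (- (1 / t)) / t ^ n) has_real_derivative
        (exp (- (1 / t)) * (1 / t\<^sup>2) * t ^ n - exp (- (1 / t)) * (real n * t ^ (n - 1))) / (t ^ n * t ^ n)) (at t)"
      using 3 by (auto intro!: derivative_eq_intros simp: power2_eq_square divide_simps)
    also have "(exp (- (1 / t)) * (1 / t\<^sup>2) * t ^ n - exp (- (1 / t)) * (real n * t ^ (n - 1))) / (t ^ n * t ^ n)
        = flat_exp (n + 2) t - real n * flat_exp (n + 1) t"
      \<comment> \<open>The case split deals with the truncated exponent \<open>n - 1\<close>: for n
        = 0 the factor \<open>real n\<close> removes that term.\<close>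
      using 3 by (cases n) (auto simp: flat_exp_def power2_eq_square divide_simps, simp_all add: algebra_simps)
    finally show ?thesis
      by (rule has_field_derivative_transform_within_open[where S = "{0<..}"])
        (use 3 in \<open>auto simp: flat_exp_def\<close>)
  qed
qed

text \<open>The index \<open>n\<close> is kept general because differentiation raises it. The outer
  function has one variable and its derivative stays in the family, so the induction needs only
  closure under sums and products.\<close>

lemma Ck_on_flat_exp:
  assumes "open S" "smooth_on S q"
  shows "Ck_on k S (\<lambda>x. flat_exp n (q x))"
proof (induction k arbitrary: n)
  case 0
  have "continuous_on UNIV (flat_exp n)"
    by (rule DERIV_continuous_on[OF has_field_derivative_at_within[OF has_real_derivative_flat_exp]])
  moreover have "continuous_on S q"
    using assms(2) Ck_on.simps(1) unfolding smooth_on_def by blast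
  ultimately show ?case
    using continuous_on_compose2 by fastforce
next
  case (Suc k)
  have q: "Ck_on j S q" for j
    using assms(2) by (simp add: smooth_on_def)
  show ?case
  proof (rule Ck_on_SucI[OF assms(1)])
    show "((\<lambda>x. flat_exp n (q x)) has_derivative (\<lambda>v. frechet_derivative q (at x) v *
        (flat_exp (n + 2) (q x) + - real n * flat_exp (n + 1) (q x)))) (at x)" if "x \<in> S" for x
      using DERIV_compose_FDERIV[OF has_real_derivative_flat_exp Ck_on_SucE[OF q that]]
      by (simp add: mult.commute)
    have "Ck_on k S (\<lambda>x. frechet_derivative q (at x) v)" for v
      using q[of "Suc k"] by simp
    then show "Ck_on k S (\<lambda>x. frechet_derivative q (at x) v *
        (flat_exp (n + 2) (q x) + - real n * flat_exp (n + 1) (q x)))" for v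
      using Suc.IH
      by (intro Ck_on_bilinear[OF bounded_bilinear_mult assms(1)] Ck_on_add[OF assms(1)]) (auto intro: Ck_on_const)
  qed
qed

lemma smooth_on_const: "smooth_on S (\<lambda>x. c)"
  by (simp add: smooth_on_def Ck_on_const)

lemma smooth_on_bilinear:
  "bounded_bilinear p \<Longrightarrow> open S \<Longrightarrow> smooth_on S f \<Longrightarrow> smooth_on S g \<Longrightarrow>
    smooth_on S (\<lambda>x. p (f x) (g x))"
  by (simp add: smooth_on_def Ck_on_bilinear)

lemma smooth_on_add:
  "open S \<Longrightarrow> smooth_on S f \<Longrightarrow> smooth_on S g \<Longrightarrow> smooth_on S (\<lambda>x. f x + g x)"
  by (simp add: smooth_on_def Ck_on_add)

lemma smooth_on_cong:
  "open S \<Longrightarrow> (\<And>x. x \<in> S \<Longrightarrow> f x = g x) \<Longrightarrow> smooth_on S f \<longleftrightarrow> smooth_on S g"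
  unfolding smooth_on_def using Ck_on_cong by blast

lemma smooth_on_subset: "smooth_on S f \<Longrightarrow> T \<subseteq> S \<Longrightarrow> smooth_on T f"
  unfolding smooth_on_def by (blast intro: Ck_on_subset)

lemma smooth_on_Union:
  "(\<And>S. S \<in> C \<Longrightarrow> open S) \<Longrightarrow> (\<And>S. S \<in> C \<Longrightarrow> smooth_on S f) \<Longrightarrow> smooth_on (\<Union>C) f"
  by (simp add: smooth_on_def Ck_on_Union)

text \<open>The sort \<open>real_inner\<close> also admits infinite dimension, so compactness has to
  come from the finite spanning set. Relative to an orthogonal one, Cauchy-Schwarz bounds the
  coefficients of the points of the ball; the ball is thus a closed part of a compact set of
  combinations.\<close>

lemma compact_cball_finite_span:
  fixes B :: "'e::real_inner set"
  assumes "finite B" "span B = UNIV"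
  shows "compact (cball (a::'e) r)"
proof -
  obtain C :: "'e set" where C: "finite C" "span C = UNIV" "pairwise orthogonal C"
    using basis_orthogonal[OF assms(1)] assms(2) by metis
  \<comment> \<open>Combinations with coefficients bounded by \<open>R\<close>. Each new vector adds
    a compact segment, and sums of compact sets are compact.\<close>
  define K where "K R D = {\<Sum>b\<in>D. c b *\<^sub>R b | c. \<forall>b\<in>D. \<bar>c b\<bar> \<le> R}" for R :: real and D :: "'e set"
  have K: "compact (K R D)" if "finite D" for R D
    using that
  proof (induction D)
    case empty
    then show ?case
      by (simp add: K_def)
  next
    case (insert b D)
    have "compact ((\<lambda>t. t *\<^sub>R b) ` {-R..R})"
      by (intro compact_continuous_image continuous_intros) simp
    then have "compact {x + y | x y. x \<in> (\<lambda>t. t *\<^sub>R b) ` {-R..R} \<and> y \<in> K R D}"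
      using insert.IH compact_sums by blast
    also have "{x + y | x y. x \<in> (\<lambda>t. t *\<^sub>R b) ` {-R..R} \<and> y \<in> K R D} = K R (insert b D)"
    proof (intro set_eqI iffI)
      fix z assume "z \<in> {x + y | x y. x \<in> (\<lambda>t. t *\<^sub>R b) ` {-R..R} \<and> y \<in> K R D}"
      then obtain t c where z: "z = t *\<^sub>R b + (\<Sum>b\<in>D. c b *\<^sub>R b)" "\<bar>t\<bar> \<le> R" "\<forall>b\<in>D. \<bar>c b\<bar> \<le> R"
        by (auto simp: K_def)
      have "(\<Sum>b\<in>D. c b *\<^sub>R b) = (\<Sum>d\<in>D. (c(b := t)) d *\<^sub>R d)"
        using insert.hyps by (intro sum.cong) auto
      then have "z = (\<Sum>d\<in>insert b D. (c(b := t)) d *\<^sub>R d)"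
        using z(1) insert.hyps by simp
      moreover have "\<forall>d\<in>insert b D. \<bar>(c(b := t)) d\<bar> \<le> R"
        using z by auto
      ultimately show "z \<in> K R (insert b D)"
        unfolding K_def by blast
    next
      fix z assume "z \<in> K R (insert b D)"
      then obtain c where z: "z = (\<Sum>d\<in>insert b D. c d *\<^sub>R d)" and c: "\<forall>d\<in>insert b D. \<bar>c d\<bar> \<le> R"
        by (auto simp: K_def)
      have "z = c b *\<^sub>R b + (\<Sum>d\<in>D. c d *\<^sub>R d)"
        using z insert.hyps by simp
      moreover have "c b *\<^sub>R b \<in> (\<lambda>t. t *\<^sub>R b) ` {-R..R}"
        using c by (intro imageI) (auto simp: abs_le_iff)
      moreover have "(\<Sum>d\<in>D. c d *\<^sub>R d) \<in> K R D"
        using c by (auto simp: K_def)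
      ultimately show "z \<in> {x + y | x y. x \<in> (\<lambda>t. t *\<^sub>R b) ` {-R..R} \<and> y \<in> K R D}"
        by blast
    qed
    finally show ?case .
  qed
  \<comment> \<open>The sum of all 1 / norm b bounds each of them. The zero vector may lie in
    \<open>C\<close>; division by zero makes its term 0, and its coefficient has no effect on the
    combination.\<close>
  obtain M where M: "\<And>b. b \<in> C \<Longrightarrow> 1 / norm b \<le> M" "M \<ge> 0"
  proof
    show "1 / norm b \<le> (\<Sum>b\<in>C. 1 / norm b)" if "b \<in> C" for b
      using that C(1) by (intro member_le_sum) auto
    show "(\<Sum>b\<in>C. 1 / norm b) \<ge> 0"
      by (intro sum_nonneg) auto
  qed
  have "cball a r \<subseteq> K ((norm a + \<bar>r\<bar>) * M) C"
  proof
    fix x assume "x \<in> cball a r"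
    then have "norm (x - a) \<le> \<bar>r\<bar>"
      by (simp add: dist_norm norm_minus_commute)
    then have nx: "norm x \<le> norm a + \<bar>r\<bar>"
      using norm_triangle_sub[of x a] by linarith
    have "x \<in> span C"
      using C(2) by simp
    then obtain c where x: "x = (\<Sum>b\<in>C. c b *\<^sub>R b)"
      using C(1) by (auto simp: span_finite)
    have x': "x = (\<Sum>b\<in>C. ((x \<bullet> b) / (b \<bullet> b)) *\<^sub>R b)"
    proof -
      have "c b *\<^sub>R b = ((x \<bullet> b) / (b \<bullet> b)) *\<^sub>R b" if "b \<in> C" for b
      proof -
        have "x \<bullet> b = (\<Sum>d\<in>C. c d * (d \<bullet> b))"
          by (simp add: x inner_sum_left)
        also have "\<dots> = (\<Sum>d\<in>C. if d = b then c b * (b \<bullet> b) else 0)"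
          using C(3) that by (intro sum.cong) (auto simp: pairwise_def orthogonal_def)
        also have "\<dots> = c b * (b \<bullet> b)"
          using C(1) that by simp
        finally show ?thesis
          by (cases "b = 0") auto
      qed
      then show ?thesis
        using x by (metis (no_types, lifting) sum.cong)
    qed
    moreover have "\<bar>(x \<bullet> b) / (b \<bullet> b)\<bar> \<le> (norm a + \<bar>r\<bar>) * M" if "b \<in> C" for b
    proof (cases "b = 0")
      case True
      then show ?thesis
        using M(2) by simp
    next
      case False
      have "\<bar>(x \<bullet> b) / (b \<bullet> b)\<bar> \<le> norm x * norm b / (norm b * norm b)"
        using Cauchy_Schwarz_ineq2[of x b]
        by (simp add: abs_divide divide_right_mono flip: power2_norm_eq_inner power2_eq_square)
      also have "\<dots> = norm x * (1 / norm b)"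
        using False by simp
      also have "\<dots> \<le> (norm a + \<bar>r\<bar>) * M"
        using nx M that by (intro mult_mono) auto
      finally show ?thesis .
    qed
    ultimately show "x \<in> K ((norm a + \<bar>r\<bar>) * M) C"
      unfolding K_def by (intro CollectI exI[of _ "\<lambda>b. (x \<bullet> b) / (b \<bullet> b)"]) blast
  qed
  then have "cball a r = K ((norm a + \<bar>r\<bar>) * M) C \<inter> cball a r"
    by blast
  then show ?thesis
    using K[OF C(1)] closed_cball compact_Int_closed by metis
qed


section \<open>Smooth functions on manifolds\<close>

locale manifold =
  fixes M :: "('m::{t2_space,second_countable_topology}, 'e::real_inner, 'z) mfd_scheme"
  assumes manifold: "smooth_manifold M"
begin

lemma chart_homeomorphism:
  "(U, \<phi>) \<in> charts M \<Longrightarrow> homeomorphism U (\<phi> ` U) \<phi> (inv_into U \<phi>)"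
  using manifold unfolding smooth_manifold_def by blast

lemma open_chart_domain: "(U, \<phi>) \<in> charts M \<Longrightarrow> open U"
  using manifold unfolding smooth_manifold_def by blast

lemma chart_inverse: "(U, \<phi>) \<in> charts M \<Longrightarrow> x \<in> U \<Longrightarrow> inv_into U \<phi> (\<phi> x) = x"
  using chart_homeomorphism unfolding homeomorphism_def by blast

lemma open_chart_image:
  assumes "(U, \<phi>) \<in> charts M" "open W"
  shows "open (\<phi> ` (U \<inter> W))"
proof -
  have "openin (top_of_set U) (U \<inter> W)"
    using assms(2) by (simp add: openin_open_Int)
  then have "openin (top_of_set (\<phi> ` U)) (\<phi> ` (U \<inter> W))"
    using homeomorphism_imp_open_map[OF chart_homeomorphism[OF assms(1)]] by blast
  moreover have "open (\<phi> ` U)"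
    using manifold assms(1) unfolding smooth_manifold_def by blast
  ultimately show ?thesis
    using openin_open_trans by blast
qed

lemma smooth_transition:
  "(U, \<phi>) \<in> charts M \<Longrightarrow> (V, \<psi>) \<in> charts M \<Longrightarrow> smooth_on (\<phi> ` (U \<inter> V)) (\<psi> \<circ> inv_into U \<phi>)"
  using manifold unfolding smooth_manifold_def by blast

lemma smooth_fun_onI:
  "(\<And>U \<phi>. (U, \<phi>) \<in> charts M \<Longrightarrow> smooth_on (\<phi> ` (U \<inter> W)) (\<lambda>y. f (inv_into U \<phi> y))) \<Longrightarrow>
    smooth_fun_on M W f"
  by (auto simp: smooth_fun_on_def comp_def)

lemma smooth_fun_onD:
  "smooth_fun_on M W f \<Longrightarrow> (U, \<phi>) \<in> charts M \<Longrightarrow>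
    smooth_on (\<phi> ` (U \<inter> W)) (\<lambda>y. f (inv_into U \<phi> y))"
  by (auto simp: smooth_fun_on_def comp_def)

lemma smooth_fun_on_cong:
  assumes "open W" "\<And>x. x \<in> W \<Longrightarrow> f x = g x"
  shows "smooth_fun_on M W f \<longleftrightarrow> smooth_fun_on M W g"
proof -
  have "smooth_on (\<phi> ` (U \<inter> W)) (\<lambda>y. f (inv_into U \<phi> y)) \<longleftrightarrow>
      smooth_on (\<phi> ` (U \<inter> W)) (\<lambda>y. g (inv_into U \<phi> y))" if "(U, \<phi>) \<in> charts M" for U \<phi>
    using assms that by (intro smooth_on_cong open_chart_image) (auto simp: chart_inverse)
  then show ?thesis
    using smooth_fun_onI smooth_fun_onD by meson
qed

lemma smooth_fun_on_eq:
  "smooth_fun_on M W g \<Longrightarrow> open W \<Longrightarrow> (\<And>x. x \<in> W \<Longrightarrow> f x = g x) \<Longrightarrow> smooth_fun_on M W f"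
  using smooth_fun_on_cong[of W f g] by simp

lemma smooth_fun_on_const: "smooth_fun_on M W (\<lambda>x. c)"
  by (rule smooth_fun_onI, rule smooth_on_const)

lemma smooth_fun_on_add:
  "open W \<Longrightarrow> smooth_fun_on M W f \<Longrightarrow> smooth_fun_on M W g \<Longrightarrow> smooth_fun_on M W (\<lambda>x. f x + g x)"
  by (rule smooth_fun_onI, rule smooth_on_add) (auto intro: open_chart_image smooth_fun_onD)

lemma smooth_fun_on_mult:
  "open W \<Longrightarrow> smooth_fun_on M W f \<Longrightarrow> smooth_fun_on M W g \<Longrightarrow> smooth_fun_on M W (\<lambda>x. f x * g x)"
  by (rule smooth_fun_onI, rule smooth_on_bilinear[OF bounded_bilinear_mult])
    (auto intro: open_chart_image smooth_fun_onD)

lemma smooth_fun_on_sum: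
  "open W \<Longrightarrow> (\<And>i. i \<in> I \<Longrightarrow> smooth_fun_on M W (f i)) \<Longrightarrow> smooth_fun_on M W (\<lambda>x. \<Sum>i\<in>I. f i x)"
  by (induction I rule: infinite_finite_induct) (auto intro: smooth_fun_on_add smooth_fun_on_const)

lemma smooth_fun_on_subset: "smooth_fun_on M W f \<Longrightarrow> V \<subseteq> W \<Longrightarrow> smooth_fun_on M V f"
  unfolding smooth_fun_on_def by (fast intro: smooth_on_subset)

lemma smooth_fun_on_Union:
  assumes "\<And>W. W \<in> C \<Longrightarrow> open W" "\<And>W. W \<in> C \<Longrightarrow> smooth_fun_on M W f"
  shows "smooth_fun_on M (\<Union>C) f"
proof (rule smooth_fun_onI)
  fix U \<phi> assume U: "(U, \<phi>) \<in> charts M"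
  have "smooth_on (\<Union>((\<lambda>W. \<phi> ` (U \<inter> W)) ` C)) (\<lambda>y. f (inv_into U \<phi> y))"
    using assms U by (intro smooth_on_Union) (auto intro: open_chart_image smooth_fun_onD)
  moreover have "\<Union>((\<lambda>W. \<phi> ` (U \<inter> W)) ` C) = \<phi> ` (U \<inter> \<Union>C)"
    by blast
  ultimately show "smooth_on (\<phi> ` (U \<inter> \<Union>C)) (\<lambda>y. f (inv_into U \<phi> y))"
    by simp
qed

text \<open>The open sets \<open>V \<inter> U\<close> and \<open>V - K\<close> cover
  \<open>V\<close> because \<open>K\<close> lies in \<open>U\<close>, and \<open>f\<close> is zero
  on the second one. A closed \<open>K\<close> inside \<open>U\<close>, and not just vanishing
  outside \<open>U\<close>, is what makes the extension by 0 smooth.\<close>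

lemma smooth_fun_on_extend_0:
  assumes "open V" "open U" "closed K" "K \<subseteq> U" "smooth_fun_on M (V \<inter> U) f"
    "\<And>x. x \<notin> K \<Longrightarrow> f x = 0"
  shows "smooth_fun_on M V f"
proof -
  have "smooth_fun_on M (V - K) f"
    using smooth_fun_on_cong[of "V - K" f "\<lambda>x. 0"] smooth_fun_on_const assms by auto
  then have "smooth_fun_on M (\<Union>{V \<inter> U, V - K}) f"
    using assms by (intro smooth_fun_on_Union) auto
  moreover have "\<Union>{V \<inter> U, V - K} = V"
    using assms(4) by blast
  ultimately show ?thesis
    by simp
qed

lemma smooth_functions_mult:
  "f \<in> smooth_functions M \<Longrightarrow> g \<in> smooth_functions M \<Longrightarrow> (\<lambda>x. f x * g x) \<in> smooth_functions M"
  by (simp add: smooth_functions_def smooth_fun_on_mult)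

lemma smooth_functions_const: "(\<lambda>x. c) \<in> smooth_functions M"
  by (simp add: smooth_functions_def smooth_fun_on_const)

lemma smooth_functions_on: "f \<in> smooth_functions M \<Longrightarrow> smooth_fun_on M W f"
  by (auto simp: smooth_functions_def intro: smooth_fun_on_subset)

text \<open>In a chart the function is \<open>flat_exp 0\<close> of r^2 - |\<phi> y - \<phi> x|^2,
  which is positive exactly inside the ball of radius r. The set \<open>K\<close> is the preimage of
  the closed ball: it is compact, hence closed because the manifold is Hausdorff.\<close>

lemma bump_function:
  assumes "open W" "x \<in> W"
  obtains f K where "f \<in> smooth_functions M" "f x \<noteq> 0" "closed K" "K \<subseteq> W" "\<And>y. y \<notin> K \<Longrightarrow> f y = 0"
proof -
  have "(\<Union>(U, \<phi>)\<in>charts M. U) = UNIV"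
    using manifold unfolding smooth_manifold_def by blast
  then have "x \<in> (\<Union>(U, \<phi>)\<in>charts M. U)"
    by simp
  then obtain U \<phi> where U: "(U, \<phi>) \<in> charts M" "x \<in> U"
    by auto
  obtain r where r: "r > 0" "cball (\<phi> x) r \<subseteq> \<phi> ` (U \<inter> W)"
    using open_chart_image[OF U(1) assms(1)] U(2) assms(2) unfolding open_contains_cball by blast
  define K where "K = inv_into U \<phi> ` cball (\<phi> x) r"
  \<comment> \<open>The difference and the squared norm are spelled out with sums, products and the
    inner product, matching the closure rules for sums and bilinear maps.\<close>
  define f where "f y = (if y \<in> U
      then flat_exp 0 (r\<^sup>2 + -1 * ((\<phi> y + - \<phi> x) \<bullet> (\<phi> y + - \<phi> x))) else 0)" for y
  have "continuous_on (\<phi> ` U) (inv_into U \<phi>)"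
    using chart_homeomorphism[OF U(1)] by (simp add: homeomorphism_def)
  then have "continuous_on (cball (\<phi> x) r) (inv_into U \<phi>)"
    using r(2) continuous_on_subset by blast
  moreover have "compact (cball (\<phi> x) r)"
  proof -
    have "\<exists>B::'e set. finite B \<and> span B = UNIV"
      using manifold unfolding smooth_manifold_def by (rule conjunct1)
    then show ?thesis
      using compact_cball_finite_span by metis
  qed
  ultimately have "closed K"
    unfolding K_def by (intro compact_imp_closed compact_continuous_image)
  have K: "K \<subseteq> U \<inter> W"
    using r(2) chart_inverse[OF U(1)] by (force simp: K_def)
  have f0: "f y = 0" if "y \<notin> K" for y
  proof (rule ccontr)
    assume "f y \<noteq> 0"
    then have y: "y \<in> U" "(\<phi> y - \<phi> x) \<bullet> (\<phi> y - \<phi> x) < r\<^sup>2"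
      by (auto simp: f_def flat_exp_def split: if_splits)
    then have "norm (\<phi> y - \<phi> x) < r"
      using r(1) by (simp add: power2_norm_eq_inner[symmetric] power2_less_imp_less)
    then have "\<phi> y \<in> cball (\<phi> x) r"
      by (simp add: dist_norm norm_minus_commute)
    then show False
      using that chart_inverse[OF U(1) y(1)] unfolding K_def by force
  qed
  have "smooth_fun_on M U f"
  proof (rule smooth_fun_onI)
    fix V \<psi> assume V: "(V, \<psi>) \<in> charts M"
    let ?S = "\<psi> ` (V \<inter> U)"
    let ?\<tau> = "\<lambda>y. \<phi> (inv_into V \<psi> y)"
    let ?q = "\<lambda>y. r\<^sup>2 + -1 * ((?\<tau> y + - \<phi> x) \<bullet> (?\<tau> y + - \<phi> x))"
    have S: "open ?S"
      using open_chart_image[OF V open_chart_domain[OF U(1)]] .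
    have "smooth_on ?S ?\<tau>"
      using smooth_transition[OF V U(1)] by (simp add: comp_def)
    then have "smooth_on ?S ?q"
      by (intro smooth_on_add smooth_on_bilinear[OF bounded_bilinear_mult]
          smooth_on_bilinear[OF bounded_bilinear_inner] smooth_on_const S)
    then have "smooth_on ?S (\<lambda>y. flat_exp 0 (?q y))"
      using Ck_on_flat_exp[OF S] by (simp add: smooth_on_def)
    moreover have "f (inv_into V \<psi> y) = flat_exp 0 (?q y)" if "y \<in> ?S" for y
      using that chart_inverse[OF V] by (auto simp: f_def)
    ultimately show "smooth_on ?S (\<lambda>y. f (inv_into V \<psi> y))"
      using smooth_on_cong[OF S, of "\<lambda>y. f (inv_into V \<psi> y)" "\<lambda>y. flat_exp 0 (?q y)"] by simp
  qed
  then have "smooth_fun_on M UNIV f"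
    using smooth_fun_on_extend_0[of UNIV U K f] open_chart_domain[OF U(1)] \<open>closed K\<close> K f0 by simp
  moreover have "f x \<noteq> 0"
    using U(2) r(1) by (simp add: f_def flat_exp_def)
  ultimately show ?thesis
    using that[of f K] \<open>closed K\<close> K f0 by (simp add: smooth_functions_def)
qed

end


section \<open>Frames and sections of vector bundles\<close>

lemma dual_space_combine:
  "\<xi> \<in> dual_space V \<Longrightarrow> \<eta> \<in> dual_space V \<Longrightarrow> (\<lambda>v. a * \<xi> v + b * \<eta> v) \<in> dual_space V"
  by (auto simp: dual_space_def algebra_simps)

lemma dual_space_zero: "(\<lambda>v. 0) \<in> dual_space V"
  by (simp add: dual_space_def)

lemma dual_space_scale: "\<xi> \<in> dual_space V \<Longrightarrow> (\<lambda>v. a * \<xi> v) \<in> dual_space V"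
  using dual_space_combine[of \<xi> V \<xi> a 0] by simp

lemma dual_space_sum:
  "(\<And>i. i \<in> I \<Longrightarrow> \<xi> i \<in> dual_space V) \<Longrightarrow> (\<lambda>v. \<Sum>i\<in>I. c i * \<xi> i v) \<in> dual_space V"
proof (induction I rule: infinite_finite_induct)
  case (insert i I)
  then show ?case
    using dual_space_combine[of "\<xi> i" V "\<lambda>v. \<Sum>i\<in>I. c i * \<xi> i v" "c i" 1] by simp
qed (simp_all add: dual_space_zero)

lemma dual_space_linear:
  assumes "\<xi> \<in> dual_space V" "u \<in> V" "v \<in> V"
  shows "\<xi> (a *\<^sub>R u + b *\<^sub>R v) = a * \<xi> u + b * \<xi> v"
  using assms by (simp add: dual_space_def)

lemma dual_space_zero_arg: "\<xi> \<in> dual_space V \<Longrightarrow> v \<in> V \<Longrightarrow> \<xi> 0 = 0"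
  using dual_space_linear[of \<xi> V v v 0 0] by simp

lemma dual_space_scaleR: "\<xi> \<in> dual_space V \<Longrightarrow> v \<in> V \<Longrightarrow> \<xi> (a *\<^sub>R v) = a * \<xi> v"
  using dual_space_linear[of \<xi> V v v a 0] by simp

lemma dual_space_sum_arg:
  assumes "\<xi> \<in> dual_space V" "subspace V" "\<And>i. i \<in> I \<Longrightarrow> v i \<in> V"
  shows "\<xi> (\<Sum>i\<in>I. c i *\<^sub>R v i) = (\<Sum>i\<in>I. c i * \<xi> (v i))"
  using assms(3)
proof (induction I rule: infinite_finite_induct)
  case (insert i I)
  have "(\<Sum>i\<in>I. c i *\<^sub>R v i) \<in> V"
    using insert.prems assms(2) by (auto intro: subspace_sum subspace_scale)
  then show ?case
    using insert dual_space_linear[OF assms(1), of "v i" "\<Sum>i\<in>I. c i *\<^sub>R v i" "c i" 1] by simp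
qed (use assms dual_space_zero_arg[OF assms(1)] subspace_0 in auto)

locale smooth_bundle =
  fixes A :: "('m::{t2_space,second_countable_topology}, 'e::real_inner, 'v::real_vector, 'z) vbundle_scheme"
  assumes vector_bundle: "vector_bundle A"

sublocale smooth_bundle \<subseteq> manifold A
  using vector_bundle by unfold_locales (simp add: vector_bundle_def)

context smooth_bundle
begin

lemma frames_cover: obtains U e where "(U, e) \<in> frames A" "x \<in> U"
proof -
  have "(\<Union>(U, e)\<in>frames A. U) = UNIV"
    using vector_bundle unfolding vector_bundle_def by blast
  then have "x \<in> (\<Union>(U, e)\<in>frames A. U)"
    by simp
  then show ?thesis
    using that by auto
qed

lemma open_frame_domain: "(U, e) \<in> frames A \<Longrightarrow> open U"
  using vector_bundle unfolding vector_bundle_def by blast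

lemma frame_basis:
  assumes "(U, e) \<in> frames A" "x \<in> U"
  shows "inj_on (\<lambda>i. e i x) {..<rank A}" "independent ((\<lambda>i. e i x) ` {..<rank A})"
    "span ((\<lambda>i. e i x) ` {..<rank A}) = fibre A x"
  using vector_bundle assms unfolding vector_bundle_def by blast+

lemma smooth_frame_transition:
  assumes "(U, e) \<in> frames A" "(U', e') \<in> frames A" "i < rank A" "j < rank A"
  shows "smooth_fun_on A (U \<inter> U') (\<lambda>x. coframe A e x i (e' j x))"
proof -
  have "\<forall>(U, e)\<in>frames A. \<forall>(U', e')\<in>frames A. \<forall>i<rank A. \<forall>j<rank A.
      smooth_fun_on A (U \<inter> U') (\<lambda>x. coframe A e x i (e' j x))"
    using vector_bundle unfolding vector_bundle_def by (elim conjE)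
  from bspec[OF this assms(1)] have "\<forall>(U', e')\<in>frames A. \<forall>i<rank A. \<forall>j<rank A.
      smooth_fun_on A (U \<inter> U') (\<lambda>x. coframe A e x i (e' j x))"
    by simp
  from bspec[OF this assms(2)] show ?thesis
    using assms(3,4) by simp
qed

lemma subspace_fibre: "subspace (fibre A x)"
  using frames_cover[of x] frame_basis(3) subspace_span by metis

lemma frame_in_fibre: "(U, e) \<in> frames A \<Longrightarrow> x \<in> U \<Longrightarrow> i < rank A \<Longrightarrow> e i x \<in> fibre A x"
  using frame_basis(3)[of U e x] span_base[of "e i x" "(\<lambda>i. e i x) ` {..<rank A}"] by blast

text \<open>Off the span of the frame \<open>representation\<close> is 0, which agrees with the
  normalisation in \<open>dual_space\<close>; on the fibre it is linear.\<close>

lemma coframe_in_dual_space: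
  assumes "(U, e) \<in> frames A" "x \<in> U"
  shows "coframe A e x i \<in> dual_space (fibre A x)"
proof -
  note b = frame_basis[OF assms]
  have "coframe A e x i v = 0" if "v \<notin> fibre A x" for v
    using that b(3) by (simp add: coframe_def representation_def)
  moreover have "coframe A e x i (a *\<^sub>R u + c *\<^sub>R v) = a * coframe A e x i u + c * coframe A e x i v"
    if "u \<in> fibre A x" "v \<in> fibre A x" for a c u v
    using that b(2) unfolding b(3)[symmetric] coframe_def
    by (simp add: representation_add representation_scale span_scale)
  ultimately show ?thesis
    by (simp add: dual_space_def)
qed

lemma frame_expansion:
  assumes "(U, e) \<in> frames A" "x \<in> U" "v \<in> fibre A x"
  shows "v = (\<Sum>i<rank A. coframe A e x i v *\<^sub>R e i x)"
proof -
  note b = frame_basis[OF assms(1,2)]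
  have "v = (\<Sum>w\<in>(\<lambda>i. e i x) ` {..<rank A}. representation ((\<lambda>i. e i x) ` {..<rank A}) v w *\<^sub>R w)"
    using sum_representation_eq[OF b(2), of v "(\<lambda>i. e i x) ` {..<rank A}"] assms(3) b(3) by simp
  then show ?thesis
    unfolding coframe_def by (subst (asm) sum.reindex[OF b(1)]) (simp add: comp_def)
qed

text \<open>This is an equality of functions on the whole ambient space: on the fibre it is the
  frame expansion of the argument, and outside both sides vanish by normalisation. So it can be
  substituted into a multivector.\<close>

lemma covector_expansion:
  assumes "(U, e) \<in> frames A" "x \<in> U" "\<xi> \<in> dual_space (fibre A x)"
  shows "\<xi> = (\<lambda>v. \<Sum>i<rank A. \<xi> (e i x) * coframe A e x i v)"
proof
  fix v
  show "\<xi> v = (\<Sum>i<rank A. \<xi> (e i x) * coframe A e x i v)"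
  proof (cases "v \<in> fibre A x")
    case True
    have "\<xi> (\<Sum>i<rank A. coframe A e x i v *\<^sub>R e i x) = (\<Sum>i<rank A. coframe A e x i v * \<xi> (e i x))"
      using assms frame_in_fibre by (intro dual_space_sum_arg[OF _ subspace_fibre]) auto
    then show ?thesis
      using frame_expansion[OF assms(1,2) True] by (simp add: mult.commute)
  next
    case False
    then show ?thesis
      using assms coframe_in_dual_space[OF assms(1,2)] by (simp add: dual_space_def)
  qed
qed

section \<open>Smooth sections of the bundle and of its dual\<close>

lemma sectionsI:
  "(\<And>x. X x \<in> fibre A x) \<Longrightarrow>
   (\<And>U e i. (U, e) \<in> frames A \<Longrightarrow> i < rank A \<Longrightarrow> smooth_fun_on A U (\<lambda>x. coframe A e x i (X x))) \<Longrightarrow>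
   X \<in> sections A"
  by (auto simp: sections_def)

lemma section_in_fibre: "X \<in> sections A \<Longrightarrow> X x \<in> fibre A x"
  by (simp add: sections_def)

lemma section_smooth:
  "X \<in> sections A \<Longrightarrow> (U, e) \<in> frames A \<Longrightarrow> i < rank A \<Longrightarrow>
    smooth_fun_on A U (\<lambda>x. coframe A e x i (X x))"
  by (auto simp: sections_def)

lemma dual_sectionsI:
  "(\<And>x. \<xi> x \<in> dual_space (fibre A x)) \<Longrightarrow>
   (\<And>U e i. (U, e) \<in> frames A \<Longrightarrow> i < rank A \<Longrightarrow> smooth_fun_on A U (\<lambda>x. \<xi> x (e i x))) \<Longrightarrow>
   \<xi> \<in> dual_sections A"
  by (auto simp: dual_sections_def)

lemma dual_section_in_dual_space: "\<xi> \<in> dual_sections A \<Longrightarrow> \<xi> x \<in> dual_space (fibre A x)"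
  by (simp add: dual_sections_def)

lemma dual_section_smooth:
  "\<xi> \<in> dual_sections A \<Longrightarrow> (U, e) \<in> frames A \<Longrightarrow> i < rank A \<Longrightarrow>
    smooth_fun_on A U (\<lambda>x. \<xi> x (e i x))"
  by (auto simp: dual_sections_def)

lemma sections_combine:
  assumes "X \<in> sections A" "Y \<in> sections A" "f \<in> smooth_functions A" "g \<in> smooth_functions A"
  shows "(\<lambda>x. f x *\<^sub>R X x + g x *\<^sub>R Y x) \<in> sections A"
proof (rule sectionsI)
  show "f x *\<^sub>R X x + g x *\<^sub>R Y x \<in> fibre A x" for x
    using assms by (intro subspace_add subspace_scale subspace_fibre section_in_fibre)
next
  fix U e i assume U: "(U, e) \<in> frames A" "i < rank A"
  have "smooth_fun_on A U (\<lambda>x. f x * coframe A e x i (X x) + g x * coframe A e x i (Y x))"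
    using assms U
    by (intro smooth_fun_on_add smooth_fun_on_mult section_smooth smooth_functions_on open_frame_domain)
  moreover have "coframe A e x i (f x *\<^sub>R X x + g x *\<^sub>R Y x) =
      f x * coframe A e x i (X x) + g x * coframe A e x i (Y x)" if "x \<in> U" for x
    using assms by (intro dual_space_linear[OF coframe_in_dual_space[OF U(1) that]] section_in_fibre)
  ultimately show "smooth_fun_on A U (\<lambda>x. coframe A e x i (f x *\<^sub>R X x + g x *\<^sub>R Y x))"
    by (rule smooth_fun_on_eq[OF _ open_frame_domain[OF U(1)]])
qed

lemma sections_scale:
  "X \<in> sections A \<Longrightarrow> f \<in> smooth_functions A \<Longrightarrow> (\<lambda>x. f x *\<^sub>R X x) \<in> sections A"
  using sections_combine[of X X f "\<lambda>x. 0"] smooth_functions_const by simp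

lemma sections_add:
  "X \<in> sections A \<Longrightarrow> Y \<in> sections A \<Longrightarrow> (\<lambda>x. X x + Y x) \<in> sections A"
  using sections_combine[of X Y "\<lambda>x. 1" "\<lambda>x. 1"] smooth_functions_const by simp

lemma sections_zero: "(\<lambda>x. 0) \<in> sections A"
proof (rule sectionsI)
  show "0 \<in> fibre A x" for x
    by (rule subspace_0[OF subspace_fibre])
next
  fix U e i assume U: "(U, e) \<in> frames A" "i < rank A"
  have "coframe A e x i 0 = 0" if "x \<in> U" for x
    using dual_space_zero_arg[OF coframe_in_dual_space[OF U(1) that]] subspace_0[OF subspace_fibre] by blast
  then show "smooth_fun_on A U (\<lambda>x. coframe A e x i 0)"
    by (rule smooth_fun_on_eq[OF smooth_fun_on_const open_frame_domain[OF U(1)]])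
qed

lemma smooth_fun_on_local:
  assumes "\<And>U e. (U, e) \<in> frames A \<Longrightarrow> smooth_fun_on A U f"
  shows "f \<in> smooth_functions A"
proof -
  have "smooth_fun_on A (\<Union>(fst ` frames A)) f"
    using assms open_frame_domain by (intro smooth_fun_on_Union) auto
  moreover have "\<Union>(fst ` frames A) = UNIV"
  proof (intro set_eqI iffI UNIV_I)
    fix x
    obtain U e where "(U, e) \<in> frames A" "x \<in> U"
      using frames_cover .
    then show "x \<in> \<Union>(fst ` frames A)"
      by force
  qed
  ultimately show ?thesis
    by (simp add: smooth_functions_def)
qed

lemma pairing_smooth:
  assumes "\<xi> \<in> dual_sections A" "X \<in> sections A"
  shows "pairing \<xi> X \<in> smooth_functions A"
proof (rule smooth_fun_on_local)
  fix U e assume U: "(U, e) \<in> frames A"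
  have "smooth_fun_on A U (\<lambda>x. \<Sum>i<rank A. \<xi> x (e i x) * coframe A e x i (X x))"
    using U assms
    by (intro smooth_fun_on_sum smooth_fun_on_mult section_smooth dual_section_smooth open_frame_domain) auto
  moreover have "pairing \<xi> X x = (\<Sum>i<rank A. \<xi> x (e i x) * coframe A e x i (X x))" if "x \<in> U" for x
    using covector_expansion[OF U that dual_section_in_dual_space[OF assms(1)]]
    unfolding pairing_def by metis
  ultimately show "smooth_fun_on A U (pairing \<xi> X)"
    by (rule smooth_fun_on_eq[OF _ open_frame_domain[OF U]])
qed

text \<open>Multiplying a local frame and its dual by a bump function \<open>f\<close> gives global sections, for which the
  expansion of a vector in the frame holds up to the factor \<open>g = f\<^sup>2\<close>.\<close>

lemma global_frame:
  obtains g X \<theta> where "g \<in> smooth_functions A" "g x \<noteq> 0"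
    "\<forall>i<rank A. X i \<in> sections A \<and> \<theta> i \<in> dual_sections A"
    "\<forall>y. \<forall>v\<in>fibre A y. g y *\<^sub>R v = (\<Sum>i<rank A. \<theta> i y v *\<^sub>R X i y)"
proof -
  obtain U e where U: "(U, e) \<in> frames A" "x \<in> U"
    using frames_cover .
  obtain f K where f: "f \<in> smooth_functions A" "f x \<noteq> 0" "closed K" "K \<subseteq> U" "\<And>y. y \<notin> K \<Longrightarrow> f y = 0"
    using bump_function[OF open_frame_domain[OF U(1)] U(2)] by metis
  define X where "X i y = (if y \<in> U then f y *\<^sub>R e i y else 0)" for i y
  define \<theta> where "\<theta> i y v = (if y \<in> U then f y * coframe A e y i v else 0)" for i y v
  have "X i \<in> sections A" if i: "i < rank A" for i
  proof (rule sectionsI)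
    show "X i y \<in> fibre A y" for y
      using frame_in_fibre[OF U(1) _ i] subspace_scale[OF subspace_fibre] subspace_0[OF subspace_fibre]
      by (auto simp: X_def)
  next
    fix U' e' k assume U': "(U', e') \<in> frames A" "k < rank A"
    have "smooth_fun_on A (U' \<inter> U) (\<lambda>y. f y * coframe A e' y k (e i y))"
      using U U' i f by (intro smooth_fun_on_mult smooth_functions_on smooth_frame_transition open_Int open_frame_domain)
    moreover have "coframe A e' y k (X i y) = f y * coframe A e' y k (e i y)" if "y \<in> U' \<inter> U" for y
      using that dual_space_scaleR[OF coframe_in_dual_space[OF U'(1)] frame_in_fibre[OF U(1) _ i]]
      by (simp add: X_def)
    ultimately have *: "smooth_fun_on A (U' \<inter> U) (\<lambda>y. coframe A e' y k (X i y))"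
      by (rule smooth_fun_on_eq[OF _ open_Int[OF open_frame_domain[OF U'(1)] open_frame_domain[OF U(1)]]])
    \<comment> \<open>The guard \<open>y \<in> U'\<close> is needed because the extension lemma asks
      for the value 0 at every point outside \<open>K\<close>, while the linearity of
      \<open>coframe A e' y\<close> is known only over \<open>U'\<close>, where \<open>e'\<close> is
      a frame.\<close>
    have "smooth_fun_on A U' (\<lambda>y. if y \<in> U' then coframe A e' y k (X i y) else 0)"
    proof (rule smooth_fun_on_extend_0[OF open_frame_domain[OF U'(1)] open_frame_domain[OF U(1)] f(3,4)])
      show "smooth_fun_on A (U' \<inter> U) (\<lambda>y. if y \<in> U' then coframe A e' y k (X i y) else 0)"
        by (rule smooth_fun_on_eq[OF * open_Int[OF open_frame_domain[OF U'(1)] open_frame_domain[OF U(1)]]]) simp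
      show "(if y \<in> U' then coframe A e' y k (X i y) else 0) = 0" if "y \<notin> K" for y
        using f(5)[OF that] dual_space_zero_arg[OF coframe_in_dual_space[OF U'(1)]]
          subspace_0[OF subspace_fibre] by (auto simp: X_def)
    qed
    then show "smooth_fun_on A U' (\<lambda>y. coframe A e' y k (X i y))"
      by (rule smooth_fun_on_eq[OF _ open_frame_domain[OF U'(1)]]) simp
  qed
  moreover have "\<theta> i \<in> dual_sections A" if i: "i < rank A" for i
  proof (rule dual_sectionsI)
    show "\<theta> i y \<in> dual_space (fibre A y)" for y
      using dual_space_scale[OF coframe_in_dual_space[OF U(1)], of y] dual_space_zero
      by (cases "y \<in> U") (simp_all add: \<theta>_def[abs_def])
  next
    fix U' e' k assume U': "(U', e') \<in> frames A" "k < rank A"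
    have "smooth_fun_on A (U \<inter> U') (\<lambda>y. f y * coframe A e y i (e' k y))"
      using U U' i f by (intro smooth_fun_on_mult smooth_functions_on smooth_frame_transition open_Int open_frame_domain)
    then have "smooth_fun_on A (U' \<inter> U) (\<lambda>y. \<theta> i y (e' k y))"
      using smooth_fun_on_cong[of "U' \<inter> U" "\<lambda>y. \<theta> i y (e' k y)" "\<lambda>y. f y * coframe A e y i (e' k y)"]
        open_Int[OF open_frame_domain[OF U'(1)] open_frame_domain[OF U(1)]] by (simp add: Int_commute \<theta>_def)
    then show "smooth_fun_on A U' (\<lambda>y. \<theta> i y (e' k y))"
      using smooth_fun_on_extend_0[OF open_frame_domain[OF U'(1)] open_frame_domain[OF U(1)] f(3,4)] f(5)
      by (simp add: \<theta>_def)
  qed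
  moreover have "(f y * f y) *\<^sub>R v = (\<Sum>i<rank A. \<theta> i y v *\<^sub>R X i y)" if v: "v \<in> fibre A y" for y v
  proof (cases "y \<in> U")
    case True
    have "(f y * f y) *\<^sub>R v = (f y * f y) *\<^sub>R (\<Sum>i<rank A. coframe A e y i v *\<^sub>R e i y)"
      using frame_expansion[OF U(1) True v] by simp
    also have "\<dots> = (\<Sum>i<rank A. \<theta> i y v *\<^sub>R X i y)"
      unfolding scaleR_sum_right using True by (intro sum.cong) (auto simp: X_def \<theta>_def mult_ac)
    finally show ?thesis .
  next
    case False
    then show ?thesis
      using f(4,5) by (auto simp: X_def \<theta>_def)
  qed
  ultimately show ?thesis
    using that[of "\<lambda>y. f y * f y" X \<theta>] f(1,2) smooth_functions_mult by simp
qed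

text \<open>At a point where \<open>g x\<close> is nonzero, the values of the global forms
  \<open>\<theta> i\<close> determine a vector. Only global dual sections are used as tests, since
  the dual relation gives information about these alone.\<close>

lemma dual_space_separates:
  assumes "u \<in> fibre A x" "v \<in> fibre A x" "\<And>\<eta>. \<eta> \<in> dual_sections A \<Longrightarrow> \<eta> x u = \<eta> x v"
  shows "u = v"
proof -
  obtain g X \<theta> where g: "g \<in> smooth_functions A" "g x \<noteq> 0"
    "\<forall>i<rank A. X i \<in> sections A \<and> \<theta> i \<in> dual_sections A"
    "\<forall>y. \<forall>v\<in>fibre A y. g y *\<^sub>R v = (\<Sum>i<rank A. \<theta> i y v *\<^sub>R X i y)"
    using global_frame[of x] .
  have "\<theta> i x u = \<theta> i x v" if "i < rank A" for i
    using g(3) assms(3) that by blast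
  then have "g x *\<^sub>R u = g x *\<^sub>R v"
    using g(4) assms(1,2) by simp
  then show ?thesis
    using g(2) by simp
qed

end


section \<open>Multivectors\<close>

lemma ext_power_outside:
  "P \<in> ext_power V p \<Longrightarrow> \<not> (length xs = p \<and> set xs \<subseteq> dual_space V) \<Longrightarrow> P xs = 0"
  unfolding ext_power_def by blast

lemma ext_power_length: "P \<in> ext_power V p \<Longrightarrow> length xs \<noteq> p \<Longrightarrow> P xs = 0"
  using ext_power_outside by blast

lemma ext_power_linear:
  assumes "P \<in> ext_power V p" "\<xi> \<in> dual_space V" "\<eta> \<in> dual_space V"
    "set xs \<subseteq> dual_space V" "set ys \<subseteq> dual_space V"
  shows "P (xs @ (\<lambda>v. a * \<xi> v + b * \<eta> v) # ys) = a * P (xs @ \<xi> # ys) + b * P (xs @ \<eta> # ys)"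
  using assms unfolding ext_power_def by blast

lemma ext_power_distinct: "P \<in> ext_power V p \<Longrightarrow> \<not> distinct xs \<Longrightarrow> P xs = 0"
  unfolding ext_power_def by blast

lemma bivector_linear_left:
  assumes "P \<in> ext_power V p" "\<xi> \<in> dual_space V" "\<eta> \<in> dual_space V" "\<zeta> \<in> dual_space V"
  shows "P [\<lambda>v. a * \<xi> v + b * \<eta> v, \<zeta>] = a * P [\<xi>, \<zeta>] + b * P [\<eta>, \<zeta>]"
  using ext_power_linear[OF assms(1-3), of "[]" "[\<zeta>]"] assms(4) by simp

lemma bivector_linear_right:
  assumes "P \<in> ext_power V p" "\<xi> \<in> dual_space V" "\<eta> \<in> dual_space V" "\<zeta> \<in> dual_space V"
  shows "P [\<zeta>, \<lambda>v. a * \<xi> v + b * \<eta> v] = a * P [\<zeta>, \<xi>] + b * P [\<zeta>, \<eta>]"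
  using ext_power_linear[OF assms(1-3), of "[\<zeta>]" "[]"] assms(4) by simp

text \<open>In \<open>ext_power\<close> alternation means vanishing on lists with a repetition.
  Expanding the value on (\<xi> + \<eta>, \<xi> + \<eta>) gives antisymmetry.\<close>

lemma bivector_antisym:
  assumes P: "P \<in> ext_power V p" and \<xi>: "\<xi> \<in> dual_space V" and \<eta>: "\<eta> \<in> dual_space V"
  shows "P [\<eta>, \<xi>] = - P [\<xi>, \<eta>]"
proof -
  let ?s = "\<lambda>v. 1 * \<xi> v + 1 * \<eta> v"
  have s: "?s \<in> dual_space V"
    using \<xi> \<eta> by (rule dual_space_combine)
  have "P [?s, ?s] = 0" "P [\<xi>, \<xi>] = 0" "P [\<eta>, \<eta>] = 0"
    by (rule ext_power_distinct[OF P], simp)+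
  moreover have "P [?s, ?s] = 1 * P [\<xi>, ?s] + 1 * P [\<eta>, ?s]"
    by (rule bivector_linear_left[OF P \<xi> \<eta> s])
  moreover have "P [\<xi>, ?s] = 1 * P [\<xi>, \<xi>] + 1 * P [\<xi>, \<eta>]"
    by (rule bivector_linear_right[OF P \<xi> \<eta> \<xi>])
  moreover have "P [\<eta>, ?s] = 1 * P [\<eta>, \<xi>] + 1 * P [\<eta>, \<eta>]"
    by (rule bivector_linear_right[OF P \<xi> \<eta> \<eta>])
  ultimately show ?thesis
    by linarith
qed

lemma bivector_sum_right:
  assumes "P \<in> ext_power V p" "\<zeta> \<in> dual_space V" "\<And>i. i \<in> I \<Longrightarrow> \<xi> i \<in> dual_space V"
  shows "P [\<zeta>, \<lambda>v. \<Sum>i\<in>I. c i * \<xi> i v] = (\<Sum>i\<in>I. c i * P [\<zeta>, \<xi> i])"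
proof -
  have zero: "P [\<zeta>, \<lambda>v. 0] = 0"
    using bivector_linear_right[OF assms(1) assms(2,2,2), of 0 0] by simp
  show ?thesis
    using assms(3)
  proof (induction I rule: infinite_finite_induct)
    case (insert i I)
    have "P [\<zeta>, \<lambda>v. c i * \<xi> i v + 1 * (\<Sum>i\<in>I. c i * \<xi> i v)] =
        c i * P [\<zeta>, \<xi> i] + 1 * P [\<zeta>, \<lambda>v. \<Sum>i\<in>I. c i * \<xi> i v]"
      using insert.prems by (intro bivector_linear_right[OF assms(1) _ _ assms(2)] dual_space_sum) auto
    then show ?case
      using insert by simp
  qed (simp_all add: zero)
qed

section \<open>Wedge products in low degree\<close>

lemma shuffle_sign_simps:
  "shuffle_sign n {} = 1"
  "shuffle_sign 1 {0} = 1"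
  "shuffle_sign 2 {0} = 1" "shuffle_sign 2 {1} = -1"
  "shuffle_sign 3 {0} = 1" "shuffle_sign 3 {1} = -1" "shuffle_sign 3 {2} = 1"
  "shuffle_sign 3 {0, 1} = 1" "shuffle_sign 3 {0, 2} = -1" "shuffle_sign 3 {1, 2} = 1"
proof -
  \<comment> \<open>\<open>J\<close> lists the inversions of the shuffle and \<open>k\<close> counts
    them. Full index sets of size 2 and 3 need no sign: in the wedge products evaluated below their
    terms vanish because one factor receives a list of the wrong length.\<close>
  have *: "shuffle_sign n I = (-1) ^ k" if "{(i, j). i \<in> I \<and> j \<in> {..<n} - I \<and> j < i} = J" "card J = k" for n I J k
    using that by (simp add: shuffle_sign_def)
  show "shuffle_sign n {} = 1"
    by (subst *[of _ _ "{}" 0]) auto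
  show "shuffle_sign 1 {0} = 1"
    by (subst *[of _ _ "{}" 0]) auto
  show "shuffle_sign 2 {0} = 1"
    by (subst *[of _ _ "{}" 0]) auto
  show "shuffle_sign 2 {1} = -1"
    by (subst *[of _ _ "{(1, 0)}" 1]) auto
  show "shuffle_sign 3 {0} = 1"
    by (subst *[of _ _ "{}" 0]) auto
  show "shuffle_sign 3 {1} = -1"
    by (subst *[of _ _ "{(1, 0)}" 1]) auto
  show "shuffle_sign 3 {2} = 1"
    by (subst *[of _ _ "{(2, 0), (2, 1)}" 2]) auto
  show "shuffle_sign 3 {0, 1} = 1"
    by (subst *[of _ _ "{}" 0]) auto
  show "shuffle_sign 3 {0, 2} = -1"
    by (subst *[of _ _ "{(2, 1)}" 1]) auto
  show "shuffle_sign 3 {1, 2} = 1"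
    by (subst *[of _ _ "{(1, 0), (2, 0)}" 2]) auto
qed

lemma nths_Compl_length: "length (nths xs I) + length (nths xs (- I)) = length xs"
proof -
  have "{i. i < length xs \<and> i \<in> I} \<union> {i. i < length xs \<and> i \<in> - I} = {..<length xs}"
    by auto
  then have "card {..<length xs} = card {i. i < length xs \<and> i \<in> I} + card {i. i < length xs \<and> i \<in> - I}"
    using card_Un_disjoint[of "{i. i < length xs \<and> i \<in> I}" "{i. i < length xs \<and> i \<in> - I}"] by auto
  then show ?thesis
    by (simp add: length_nths)
qed

lemma set_nths_Compl: "set xs = set (nths xs I) \<union> set (nths xs (- I))"
  unfolding set_nths set_conv_nth[of xs] by blast

text \<open>If some shuffle term were nonzero, both sublists would consist of covectors and have
  lengths \<open>p\<close> and \<open>q\<close>; together they make up \<open>xs\<close>, which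
  would then be admissible.\<close>

lemma wedge_outside:
  assumes "P x \<in> ext_power V p" "Q x \<in> ext_power V q"
    "\<not> (length xs = p + q \<and> set xs \<subseteq> dual_space V)"
  shows "wedge P Q x xs = 0"
proof -
  have "P x (nths xs I) * Q x (nths xs (- I)) = 0" for I
  proof (rule ccontr)
    assume "P x (nths xs I) * Q x (nths xs (- I)) \<noteq> 0"
    then have "P x (nths xs I) \<noteq> 0" "Q x (nths xs (- I)) \<noteq> 0"
      by auto
    then have "length (nths xs I) = p \<and> set (nths xs I) \<subseteq> dual_space V"
      "length (nths xs (- I)) = q \<and> set (nths xs (- I)) \<subseteq> dual_space V"
      using ext_power_outside[OF assms(1)] ext_power_outside[OF assms(2)] by metis+
    then show False
      using assms(3) nths_Compl_length[of xs I] set_nths_Compl[of xs I] by auto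
  qed
  then have "shuffle_sign (length xs) I * P x (nths xs I) * Q x (nths xs (- I)) = 0" for I
    using mult.assoc mult_zero_right by metis
  then show ?thesis
    unfolding wedge_def by (intro sum.neutral) blast
qed

text \<open>Subsets are split by whether they contain \<open>a\<close>. Applied repeatedly, this
  unrolls the sum over shuffles into explicit terms.\<close>

lemma sum_Pow_insert:
  assumes "finite A" "a \<notin> A"
  shows "sum F (Pow (insert a A)) = sum F (Pow A) + (\<Sum>I\<in>Pow A. F (insert a I))"
proof -
  have "inj_on (insert a) (Pow A)"
    using assms(2) by (intro inj_onI) (metis PowD insert_ident subsetD)
  then have "sum F (insert a ` Pow A) = (\<Sum>I\<in>Pow A. F (insert a I))"
    by (simp add: sum.reindex)
  moreover have "Pow A \<inter> insert a ` Pow A = {}"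
    using assms(2) by blast
  ultimately show ?thesis
    unfolding Pow_insert using assms(1) by (simp add: sum.union_disjoint)
qed

lemma lessThan_1_2_3: "{..<1} = {0::nat}" "{..<2} = {0, 1::nat}" "{..<3} = {0, 1, 2::nat}"
  by auto

lemma wedge_1_1:
  assumes "P x \<in> ext_power V 1" "Q x \<in> ext_power V 1"
  shows "wedge P Q x [a, b] = P x [a] * Q x [b] - P x [b] * Q x [a]"
proof -
  have "wedge P Q x [a, b] = (\<Sum>I\<in>Pow {..<2}.
      shuffle_sign 2 I * P x (nths [a, b] I) * Q x (nths [a, b] (- I)))"
    by (simp add: wedge_def numeral_2_eq_2)
  also have "\<dots> = P x [a] * Q x [b] - P x [b] * Q x [a]"
    unfolding lessThan_1_2_3 using ext_power_length[OF assms(1)] ext_power_length[OF assms(2)]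
    by (simp add: sum_Pow_insert nths_Cons shuffle_sign_simps[simplified])
  finally show ?thesis .
qed

lemma wedge_1_2:
  assumes "P x \<in> ext_power V 1" "Q x \<in> ext_power V 2"
  shows "wedge P Q x [a, b, c] = P x [a] * Q x [b, c] - P x [b] * Q x [a, c] + P x [c] * Q x [a, b]"
proof -
  have "wedge P Q x [a, b, c] = (\<Sum>I\<in>Pow {..<3}.
      shuffle_sign 3 I * P x (nths [a, b, c] I) * Q x (nths [a, b, c] (- I)))"
    by (simp add: wedge_def numeral_3_eq_3)
  also have "\<dots> = P x [a] * Q x [b, c] - P x [b] * Q x [a, c] + P x [c] * Q x [a, b]"
    unfolding lessThan_1_2_3 using ext_power_length[OF assms(1)] ext_power_length[OF assms(2)]
    by (simp add: sum_Pow_insert nths_Cons shuffle_sign_simps[simplified])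
  finally show ?thesis .
qed

lemma wedge_2_1:
  assumes "P x \<in> ext_power V 2" "Q x \<in> ext_power V 1"
  shows "wedge P Q x [a, b, c] = P x [a, b] * Q x [c] - P x [a, c] * Q x [b] + P x [b, c] * Q x [a]"
proof -
  have "wedge P Q x [a, b, c] = (\<Sum>I\<in>Pow {..<3}.
      shuffle_sign 3 I * P x (nths [a, b, c] I) * Q x (nths [a, b, c] (- I)))"
    by (simp add: wedge_def numeral_3_eq_3)
  also have "\<dots> = P x [a, b] * Q x [c] - P x [a, c] * Q x [b] + P x [b, c] * Q x [a]"
    unfolding lessThan_1_2_3 using ext_power_length[OF assms(1)] ext_power_length[OF assms(2)]
    by (simp add: sum_Pow_insert nths_Cons shuffle_sign_simps[simplified])
  finally show ?thesis .
qed

text \<open>Since \<open>mv_of_fun f\<close> lives on the empty list, only the empty index set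
  contributes. Multiplication by a function is thus a wedge product, and the Leibniz axiom of the
  Schouten bracket applies to it.\<close>

lemma wedge_fun_left: "wedge (mv_of_fun f) P x xs = f x * P x xs"
proof -
  have "wedge (mv_of_fun f) P x xs = (\<Sum>I\<in>Pow {..<length xs}. if I = {} then f x * P x xs else 0)"
    unfolding wedge_def
  proof (rule sum.cong[OF refl])
    fix I assume I: "I \<in> Pow {..<length xs}"
    show "shuffle_sign (length xs) I * mv_of_fun f x (nths xs I) * P x (nths xs (- I)) =
        (if I = {} then f x * P x xs else 0)"
    proof (cases "I = {}")
      case True
      then show ?thesis
        by (simp add: shuffle_sign_simps mv_of_fun_def nths_all)
    next
      case False
      then have "set (nths xs I) \<noteq> {}"
        using I by (auto simp: set_nths)
      then show ?thesis
        using False by (simp add: mv_of_fun_def)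
    qed
  qed
  then show ?thesis
    by simp
qed

lemma wedge_fun_right_1: "wedge P (mv_of_fun f) x [a] = f x * P x [a]"
proof -
  have "wedge P (mv_of_fun f) x [a] = (\<Sum>I\<in>Pow {..<1}.
      shuffle_sign 1 I * P x (nths [a] I) * mv_of_fun f x (nths [a] (- I)))"
    by (simp add: wedge_def)
  also have "\<dots> = f x * P x [a]"
    unfolding lessThan_1_2_3 by (simp add: sum_Pow_insert mv_of_fun_def shuffle_sign_simps[simplified])
  finally show ?thesis .
qed

context smooth_bundle
begin

section \<open>Smooth multivector fields\<close>

lemma mv_sections_ext_power: "P \<in> mv_sections A p \<Longrightarrow> P x \<in> ext_power (fibre A x) p"
  by (simp add: mv_sections_def)

lemma wedge_bivector_right:
  assumes "P \<in> mv_sections A 1" "Q \<in> mv_sections A 2"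
  shows "wedge P Q x [a, b, c] = P x [a] * Q x [b, c] - P x [b] * Q x [a, c] + P x [c] * Q x [a, b]"
  by (rule wedge_1_2) (rule mv_sections_ext_power[OF assms(1)], rule mv_sections_ext_power[OF assms(2)])

lemma wedge_bivector_left:
  assumes "P \<in> mv_sections A 2" "Q \<in> mv_sections A 1"
  shows "wedge P Q x [a, b, c] = P x [a, b] * Q x [c] - P x [a, c] * Q x [b] + P x [b, c] * Q x [a]"
  by (rule wedge_2_1) (rule mv_sections_ext_power[OF assms(1)], rule mv_sections_ext_power[OF assms(2)])

lemma mv_sections_smooth:
  "P \<in> mv_sections A p \<Longrightarrow> (U, e) \<in> frames A \<Longrightarrow> length is = p \<Longrightarrow> set is \<subseteq> {..<rank A} \<Longrightarrow>
    smooth_fun_on A U (\<lambda>x. P x (map (coframe A e x) is))"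
  by (auto simp: mv_sections_def)

text \<open>On lists of the wrong length or with entries outside the dual space all values are 0 by
  the first premise, so multilinearity and alternation have content only on admissible
  lists.\<close>

lemma mv_sectionsI:
  assumes "\<And>x xs. \<not> (length xs = p \<and> set xs \<subseteq> dual_space (fibre A x)) \<Longrightarrow> P x xs = 0"
    "\<And>x xs ys \<xi> \<eta> a b. \<xi> \<in> dual_space (fibre A x) \<Longrightarrow> \<eta> \<in> dual_space (fibre A x) \<Longrightarrow>
      set xs \<subseteq> dual_space (fibre A x) \<Longrightarrow> set ys \<subseteq> dual_space (fibre A x) \<Longrightarrow>
      Suc (length xs + length ys) = p \<Longrightarrow>
      P x (xs @ (\<lambda>v. a * \<xi> v + b * \<eta> v) # ys) = a * P x (xs @ \<xi> # ys) + b * P x (xs @ \<eta> # ys)"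
    "\<And>x xs. \<not> distinct xs \<Longrightarrow> length xs = p \<Longrightarrow> set xs \<subseteq> dual_space (fibre A x) \<Longrightarrow> P x xs = 0"
    "\<And>U e is. (U, e) \<in> frames A \<Longrightarrow> length is = p \<Longrightarrow> set is \<subseteq> {..<rank A} \<Longrightarrow>
      smooth_fun_on A U (\<lambda>x. P x (map (coframe A e x) is))"
  shows "P \<in> mv_sections A p"
proof -
  have "P x \<in> ext_power (fibre A x) p" for x
    unfolding ext_power_def
  proof (intro CollectI conjI allI ballI impI)
    fix xs ys \<xi> \<eta> and a b :: real
    assume *: "\<xi> \<in> dual_space (fibre A x)" "\<eta> \<in> dual_space (fibre A x)"
      "set xs \<subseteq> dual_space (fibre A x)" "set ys \<subseteq> dual_space (fibre A x)"
    show "P x (xs @ (\<lambda>v. a * \<xi> v + b * \<eta> v) # ys) = a * P x (xs @ \<xi> # ys) + b * P x (xs @ \<eta> # ys)"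
    proof (cases "Suc (length xs + length ys) = p")
      case True
      then show ?thesis
        using assms(2)[OF *] by blast
    next
      case False
      then show ?thesis
        by (simp add: assms(1))
    qed
  next
    fix xs :: "('v \<Rightarrow> real) list"
    assume "\<not> distinct xs"
    then show "P x xs = 0"
      using assms(1)[of xs x] assms(3)[of xs x] by metis
  qed (rule assms(1))
  then show ?thesis
    using assms(4) by (auto simp: mv_sections_def)
qed

lemma bivector_eqI:
  assumes "P \<in> mv_sections A 2" "Q \<in> mv_sections A 2"
    "\<And>x \<xi> \<eta>. \<xi> \<in> dual_space (fibre A x) \<Longrightarrow> \<eta> \<in> dual_space (fibre A x) \<Longrightarrow> P x [\<xi>, \<eta>] = Q x [\<xi>, \<eta>]"
  shows "P = Q"
proof (intro ext)
  fix x and xs :: "('v \<Rightarrow> real) list"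
  show "P x xs = Q x xs"
  proof (cases "length xs = 2 \<and> set xs \<subseteq> dual_space (fibre A x)")
    case True
    then obtain \<xi> \<eta> where "xs = [\<xi>, \<eta>]"
      by (auto simp: length_Suc_conv numeral_2_eq_2)
    then show ?thesis
      using True assms(3) by simp
  next
    case False
    then show ?thesis
      using ext_power_outside[OF mv_sections_ext_power[OF assms(1)]]
        ext_power_outside[OF mv_sections_ext_power[OF assms(2)]] by metis
  qed
qed

lemma mv_of_section_eval: "\<xi> \<in> dual_space (fibre A x) \<Longrightarrow> mv_of_section A X x [\<xi>] = \<xi> (X x)"
  by (simp add: mv_of_section_def)

lemma mv_of_fun_mv_sections:
  assumes "f \<in> smooth_functions A"
  shows "mv_of_fun f \<in> mv_sections A 0"
  using assms by (intro mv_sectionsI) (auto simp: mv_of_fun_def intro: smooth_functions_on)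

lemma mv_of_section_mv_sections:
  assumes "X \<in> sections A"
  shows "mv_of_section A X \<in> mv_sections A 1"
proof (rule mv_sectionsI)
  fix U e "is" assume *: "(U, e) \<in> frames A" "length is = 1" "set is \<subseteq> {..<rank A}"
  then obtain i where i: "is = [i]" "i < rank A"
    by (auto simp: length_Suc_conv)
  show "smooth_fun_on A U (\<lambda>x. mv_of_section A X x (map (coframe A e x) is))"
    by (rule smooth_fun_on_eq[OF section_smooth[OF assms *(1) i(2)] open_frame_domain[OF *(1)]])
      (simp add: i(1) mv_of_section_eval coframe_in_dual_space[OF *(1)])
qed (auto simp: mv_of_section_def dual_space_combine length_Suc_conv)

lemma mv_add_mv_sections:
  assumes "P \<in> mv_sections A p" "Q \<in> mv_sections A p"
  shows "mv_add P Q \<in> mv_sections A p"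
proof (rule mv_sectionsI)
  note P = mv_sections_ext_power[OF assms(1)] and Q = mv_sections_ext_power[OF assms(2)]
  show "mv_add P Q x xs = 0" if "\<not> (length xs = p \<and> set xs \<subseteq> dual_space (fibre A x))" for x xs
    using ext_power_outside[OF P that] ext_power_outside[OF Q that] by (simp add: mv_add_def)
  show "mv_add P Q x xs = 0" if "\<not> distinct xs" for x xs
    using ext_power_distinct[OF P that] ext_power_distinct[OF Q that] by (simp add: mv_add_def)
  show "mv_add P Q x (xs @ (\<lambda>v. a * \<xi> v + b * \<eta> v) # ys) =
      a * mv_add P Q x (xs @ \<xi> # ys) + b * mv_add P Q x (xs @ \<eta> # ys)"
    if "\<xi> \<in> dual_space (fibre A x)" "\<eta> \<in> dual_space (fibre A x)"
      "set xs \<subseteq> dual_space (fibre A x)" "set ys \<subseteq> dual_space (fibre A x)" for x xs ys \<xi> \<eta> a b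
    using ext_power_linear[OF P that, of a b] ext_power_linear[OF Q that, of a b]
    by (simp add: mv_add_def algebra_simps)
  show "smooth_fun_on A U (\<lambda>x. mv_add P Q x (map (coframe A e x) is))"
    if "(U, e) \<in> frames A" "length is = p" "set is \<subseteq> {..<rank A}" for U e "is"
    unfolding mv_add_def
    using that assms by (intro smooth_fun_on_add mv_sections_smooth open_frame_domain)
qed

lemma fun_wedge_mv_sections:
  assumes "f \<in> smooth_functions A" "P \<in> mv_sections A p"
  shows "wedge (mv_of_fun f) P \<in> mv_sections A p"
proof (rule mv_sectionsI)
  note P = mv_sections_ext_power[OF assms(2)]
  show "wedge (mv_of_fun f) P x xs = 0" if "\<not> (length xs = p \<and> set xs \<subseteq> dual_space (fibre A x))" for x xs
    using ext_power_outside[OF P that] by (simp add: wedge_fun_left)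
  show "wedge (mv_of_fun f) P x xs = 0" if "\<not> distinct xs" for x xs
    using ext_power_distinct[OF P that] by (simp add: wedge_fun_left)
  show "wedge (mv_of_fun f) P x (xs @ (\<lambda>v. a * \<xi> v + b * \<eta> v) # ys) =
      a * wedge (mv_of_fun f) P x (xs @ \<xi> # ys) + b * wedge (mv_of_fun f) P x (xs @ \<eta> # ys)"
    if "\<xi> \<in> dual_space (fibre A x)" "\<eta> \<in> dual_space (fibre A x)"
      "set xs \<subseteq> dual_space (fibre A x)" "set ys \<subseteq> dual_space (fibre A x)" for x xs ys \<xi> \<eta> a b
    using ext_power_linear[OF P that, of a b] by (simp add: wedge_fun_left algebra_simps)
  show "smooth_fun_on A U (\<lambda>x. wedge (mv_of_fun f) P x (map (coframe A e x) is))"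
    if "(U, e) \<in> frames A" "length is = p" "set is \<subseteq> {..<rank A}" for U e "is"
    unfolding wedge_fun_left
    using that assms by (intro smooth_fun_on_mult mv_sections_smooth open_frame_domain smooth_functions_on)
qed

abbreviation section_wedge :: "('m \<Rightarrow> 'v) \<Rightarrow> ('m \<Rightarrow> 'v) \<Rightarrow> ('m, 'v) mvfield" where
  "section_wedge X Y \<equiv> wedge (mv_of_section A X) (mv_of_section A Y)"

lemma section_wedge_eval:
  assumes "X \<in> sections A" "Y \<in> sections A" "\<xi> \<in> dual_space (fibre A x)" "\<eta> \<in> dual_space (fibre A x)"
  shows "section_wedge X Y x [\<xi>, \<eta>] = \<xi> (X x) * \<eta> (Y x) - \<eta> (X x) * \<xi> (Y x)"
  by (subst wedge_1_1[where V = "fibre A x"])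
    (use assms in \<open>auto simp: mv_of_section_eval intro: mv_sections_ext_power mv_of_section_mv_sections[simplified]\<close>)

lemma section_wedge_mv_sections:
  assumes "X \<in> sections A" "Y \<in> sections A"
  shows "section_wedge X Y \<in> mv_sections A 2"
proof (rule mv_sectionsI)
  note X = mv_sections_ext_power[OF mv_of_section_mv_sections[OF assms(1)]]
    and Y = mv_sections_ext_power[OF mv_of_section_mv_sections[OF assms(2)]]
  note eval = section_wedge_eval[OF assms]
  show "section_wedge X Y x xs = 0" if "\<not> (length xs = 2 \<and> set xs \<subseteq> dual_space (fibre A x))" for x xs
    using that by (intro wedge_outside[where P = "mv_of_section A X" and Q = "mv_of_section A Y", OF X Y]) simp
  show "section_wedge X Y x xs = 0"
    if *: "\<not> distinct xs" "length xs = 2" "set xs \<subseteq> dual_space (fibre A x)" for x xs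
  proof -
    obtain \<xi> \<eta> where "xs = [\<xi>, \<eta>]"
      using *(2) by (auto simp: length_Suc_conv numeral_2_eq_2)
    then show ?thesis
      using * eval by auto
  qed
  show "section_wedge X Y x (xs @ (\<lambda>v. a * \<xi> v + b * \<eta> v) # ys) =
      a * section_wedge X Y x (xs @ \<xi> # ys) + b * section_wedge X Y x (xs @ \<eta> # ys)"
    if *: "\<xi> \<in> dual_space (fibre A x)" "\<eta> \<in> dual_space (fibre A x)"
      "set xs \<subseteq> dual_space (fibre A x)" "set ys \<subseteq> dual_space (fibre A x)"
      "Suc (length xs + length ys) = 2" for x xs ys \<xi> \<eta> a b
  proof -
    consider \<zeta> where "xs = []" "ys = [\<zeta>]" | \<zeta> where "xs = [\<zeta>]" "ys = []"
      using *(5) by (cases xs; cases ys) auto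
    then show ?thesis
      using * by cases (simp_all add: eval dual_space_combine algebra_simps)
  qed
  show "smooth_fun_on A U (\<lambda>x. section_wedge X Y x (map (coframe A e x) is))"
    if *: "(U, e) \<in> frames A" "length is = 2" "set is \<subseteq> {..<rank A}" for U e "is"
  proof -
    obtain i j where ij: "is = [i, j]" "i < rank A" "j < rank A"
      using *(2,3) by (auto simp: length_Suc_conv numeral_2_eq_2)
    have "smooth_fun_on A U (\<lambda>x. coframe A e x i (X x) * coframe A e x j (Y x)
        + -1 * (coframe A e x j (X x) * coframe A e x i (Y x)))"
      using *(1) ij assms
      by (intro smooth_fun_on_add smooth_fun_on_mult smooth_fun_on_const section_smooth open_frame_domain)
    then show ?thesis
      by (rule smooth_fun_on_eq[OF _ open_frame_domain[OF *(1)]])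
        (simp add: ij(1) eval coframe_in_dual_space[OF *(1)])
  qed
qed

section \<open>The map from forms to sections induced by a bivector field\<close>

lemma sharp_eqI:
  assumes "v \<in> fibre A x" "\<And>\<eta>. \<eta> \<in> dual_space (fibre A x) \<Longrightarrow> \<eta> v = P x [\<xi> x, \<eta>]"
  shows "sharp A P \<xi> x = v"
  unfolding sharp_def
proof (rule the_equality)
  show "v \<in> fibre A x \<and> (\<forall>\<eta>\<in>dual_space (fibre A x). \<eta> v = P x [\<xi> x, \<eta>])"
    using assms by blast
  fix w assume w: "w \<in> fibre A x \<and> (\<forall>\<eta>\<in>dual_space (fibre A x). \<eta> w = P x [\<xi> x, \<eta>])"
  \<comment> \<open>Uniqueness in the definite description defining \<open>sharp\<close> rests on
    the fact that dual sections separate the vectors of a fibre.\<close>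
  show "w = v"
  proof (rule dual_space_separates)
    show "\<eta> x w = \<eta> x v" if "\<eta> \<in> dual_sections A" for \<eta>
      using w assms(2) dual_section_in_dual_space[OF that, of x] by metis
  qed (use w assms(1) in blast)+
qed

lemma sharp_exists:
  assumes "P \<in> mv_sections A 2" "\<xi> \<in> dual_sections A"
  shows "sharp A P \<xi> x \<in> fibre A x \<and> (\<forall>\<eta>\<in>dual_space (fibre A x). \<eta> (sharp A P \<xi> x) = P x [\<xi> x, \<eta>])"
proof -
  obtain U e where U: "(U, e) \<in> frames A" "x \<in> U"
    using frames_cover .
  note \<xi> = dual_section_in_dual_space[OF assms(2), of x]
  \<comment> \<open>The condition defining \<open>sharp\<close>, tested on the coframe, prescribes
    the coordinates of the vector in the frame.\<close>
  define v where "v = (\<Sum>i<rank A. P x [\<xi> x, coframe A e x i] *\<^sub>R e i x)"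
  have v: "v \<in> fibre A x"
    unfolding v_def using frame_in_fibre[OF U]
    by (intro subspace_sum subspace_scale subspace_fibre) simp
  have *: "\<eta> v = P x [\<xi> x, \<eta>]" if "\<eta> \<in> dual_space (fibre A x)" for \<eta>
  proof -
    have "P x [\<xi> x, \<eta>] = P x [\<xi> x, \<lambda>v. \<Sum>i<rank A. \<eta> (e i x) * coframe A e x i v]"
      using covector_expansion[OF U that] by metis
    also have "\<dots> = (\<Sum>i<rank A. \<eta> (e i x) * P x [\<xi> x, coframe A e x i])"
      by (intro bivector_sum_right[OF mv_sections_ext_power[OF assms(1)] \<xi>] coframe_in_dual_space[OF U])
    also have "\<dots> = \<eta> v"
      unfolding v_def using frame_in_fibre[OF U]
      by (subst dual_space_sum_arg[OF that subspace_fibre]) (auto simp: mult.commute)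
    finally show ?thesis
      by simp
  qed
  have "sharp A P \<xi> x = v"
    by (rule sharp_eqI[where P = P and \<xi> = \<xi>, OF v *])
  then show ?thesis
    using v * by simp
qed

lemma sharp_eval:
  "P \<in> mv_sections A 2 \<Longrightarrow> \<xi> \<in> dual_sections A \<Longrightarrow> \<eta> \<in> dual_space (fibre A x) \<Longrightarrow>
    \<eta> (sharp A P \<xi> x) = P x [\<xi> x, \<eta>]"
  using sharp_exists by blast

lemma sharp_in_fibre:
  "P \<in> mv_sections A 2 \<Longrightarrow> \<xi> \<in> dual_sections A \<Longrightarrow> sharp A P \<xi> x \<in> fibre A x"
  using sharp_exists by blast

lemma pairing_sharp:
  "P \<in> mv_sections A 2 \<Longrightarrow> \<xi> \<in> dual_sections A \<Longrightarrow> \<eta> \<in> dual_sections A \<Longrightarrow>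
    pairing \<eta> (sharp A P \<xi>) x = P x [\<xi> x, \<eta> x]"
  by (simp add: pairing_def sharp_eval dual_section_in_dual_space)

lemma pairing_sharp_antisym:
  assumes "P \<in> mv_sections A 2" "\<xi> \<in> dual_sections A" "\<eta> \<in> dual_sections A"
  shows "pairing \<xi> (sharp A P \<eta>) x = - pairing \<eta> (sharp A P \<xi>) x"
  using assms bivector_antisym[OF mv_sections_ext_power]
  by (simp add: pairing_sharp dual_section_in_dual_space)

lemma sharp_sections:
  assumes "P \<in> mv_sections A 2" "\<xi> \<in> dual_sections A"
  shows "sharp A P \<xi> \<in> sections A"
proof (rule sectionsI)
  show "sharp A P \<xi> x \<in> fibre A x" for x
    using assms by (rule sharp_in_fibre)
next
  fix U e i assume U: "(U, e) \<in> frames A" and i: "i < rank A"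
  have "smooth_fun_on A U (\<lambda>x. P x (map (coframe A e x) [j, i]))" if "j < rank A" for j
    using that i by (intro mv_sections_smooth[OF assms(1) U]) auto
  then have "smooth_fun_on A U (\<lambda>x. \<Sum>j<rank A. \<xi> x (e j x) * (-1 * P x [coframe A e x i, coframe A e x j]))"
    using mv_sections_smooth[OF assms(1) U, of "[i, _]"] i
    by (intro smooth_fun_on_sum smooth_fun_on_mult smooth_fun_on_const dual_section_smooth[OF assms(2) U]
        open_frame_domain[OF U]) auto
  moreover have "coframe A e x i (sharp A P \<xi> x) =
      (\<Sum>j<rank A. \<xi> x (e j x) * (-1 * P x [coframe A e x i, coframe A e x j]))" if "x \<in> U" for x
  proof -
    note \<xi> = dual_section_in_dual_space[OF assms(2), of x] and c = coframe_in_dual_space[OF U that]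
      and P = mv_sections_ext_power[OF assms(1), of x]
    \<comment> \<open>The arguments are exchanged so that \<xi> stands in the second slot, where
      \<open>bivector_sum_right\<close> expands it in the coframe.\<close>
    have "coframe A e x i (sharp A P \<xi> x) = - P x [coframe A e x i, \<xi> x]"
      using sharp_eval[OF assms c] bivector_antisym[OF P c \<xi>] by simp
    also have "P x [coframe A e x i, \<xi> x] =
        P x [coframe A e x i, \<lambda>v. \<Sum>j<rank A. \<xi> x (e j x) * coframe A e x j v]"
      using covector_expansion[OF U that \<xi>] by metis
    also have "\<dots> = (\<Sum>j<rank A. \<xi> x (e j x) * P x [coframe A e x i, coframe A e x j])"
      by (rule bivector_sum_right[OF P c c])
    finally show ?thesis
      by (simp add: sum_negf)
  qed
  ultimately show "smooth_fun_on A U (\<lambda>x. coframe A e x i (sharp A P \<xi> x))"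
    by (rule smooth_fun_on_eq[OF _ open_frame_domain[OF U]])
qed

lemma sharp_add:
  assumes "P \<in> mv_sections A 2" "Q \<in> mv_sections A 2" "\<xi> \<in> dual_sections A"
  shows "sharp A (mv_add P Q) \<xi> = (\<lambda>x. sharp A P \<xi> x + sharp A Q \<xi> x)"
proof (rule ext, rule sharp_eqI)
  fix x
  show "sharp A P \<xi> x + sharp A Q \<xi> x \<in> fibre A x"
    using assms by (intro subspace_add subspace_fibre sharp_in_fibre)
  fix \<eta> assume \<eta>: "\<eta> \<in> dual_space (fibre A x)"
  show "\<eta> (sharp A P \<xi> x + sharp A Q \<xi> x) = mv_add P Q x [\<xi> x, \<eta>]"
    using dual_space_linear[OF \<eta> sharp_in_fibre[OF assms(1,3)] sharp_in_fibre[OF assms(2,3)], of 1 1]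
      assms \<eta> by (simp add: sharp_eval mv_add_def)
qed

lemma sharp_scale:
  assumes "P \<in> mv_sections A 2" "\<xi> \<in> dual_sections A"
  shows "sharp A (wedge (mv_of_fun f) P) \<xi> = (\<lambda>x. f x *\<^sub>R sharp A P \<xi> x)"
proof (rule ext, rule sharp_eqI)
  fix x
  show "f x *\<^sub>R sharp A P \<xi> x \<in> fibre A x"
    using assms by (intro subspace_scale subspace_fibre sharp_in_fibre)
  fix \<eta> assume \<eta>: "\<eta> \<in> dual_space (fibre A x)"
  show "\<eta> (f x *\<^sub>R sharp A P \<xi> x) = wedge (mv_of_fun f) P x [\<xi> x, \<eta>]"
    using dual_space_scaleR[OF \<eta> sharp_in_fibre[OF assms]] assms \<eta>
    by (simp add: sharp_eval wedge_fun_left)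
qed

text \<open>The sign is kept inside the second coefficient, so that the result has the form f Y + g
  X to which \<open>act_combine_section\<close> and \<open>pairing_bracket_combine\<close>
  apply.\<close>

lemma sharp_section_wedge:
  assumes "X \<in> sections A" "Y \<in> sections A" "\<xi> \<in> dual_sections A"
  shows "sharp A (section_wedge X Y) \<xi> = (\<lambda>x. pairing \<xi> X x *\<^sub>R Y x + (- pairing \<xi> Y x) *\<^sub>R X x)"
proof (rule ext, rule sharp_eqI)
  fix x
  show "pairing \<xi> X x *\<^sub>R Y x + (- pairing \<xi> Y x) *\<^sub>R X x \<in> fibre A x"
    using assms by (intro subspace_add subspace_scale subspace_fibre section_in_fibre)
  fix \<eta> assume \<eta>: "\<eta> \<in> dual_space (fibre A x)"
  have "\<eta> (pairing \<xi> X x *\<^sub>R Y x + (- pairing \<xi> Y x) *\<^sub>R X x) =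
      pairing \<xi> X x * \<eta> (Y x) + (- pairing \<xi> Y x) * \<eta> (X x)"
    using assms by (intro dual_space_linear[OF \<eta>] section_in_fibre)
  then show "\<eta> (pairing \<xi> X x *\<^sub>R Y x + (- pairing \<xi> Y x) *\<^sub>R X x) = section_wedge X Y x [\<xi> x, \<eta>]"
    using assms \<eta> by (simp add: section_wedge_eval dual_section_in_dual_space pairing_def)
qed

text \<open>Finite sums of products of two global sections. Scalar and function coefficients can be
  absorbed into a factor, so two rules suffice, and an induction meets only one product and the sum
  of two members.\<close>

inductive_set decomposables :: "('m, 'v) mvfield set" where
  wedge: "X \<in> sections A \<Longrightarrow> Y \<in> sections A \<Longrightarrow> section_wedge X Y \<in> decomposables"
| add: "P \<in> decomposables \<Longrightarrow> Q \<in> decomposables \<Longrightarrow> mv_add P Q \<in> decomposables"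

lemma decomposables_mv_sections: "P \<in> decomposables \<Longrightarrow> P \<in> mv_sections A 2"
  by (induction rule: decomposables.induct) (auto intro: section_wedge_mv_sections mv_add_mv_sections)

lemma sum_section_wedge_decomposable:
  fixes n :: nat
  assumes "\<And>i. i < n \<Longrightarrow> X i \<in> sections A" "\<And>i. i < n \<Longrightarrow> Y i \<in> sections A"
  shows "\<exists>Q\<in>decomposables. \<forall>x xs. Q x xs = (\<Sum>i<n. section_wedge (X i) (Y i) x xs)"
  using assms
proof (induction n)
  case 0
  \<comment> \<open>The empty sum is a member as the product of the zero section with
    itself.\<close>
  have "section_wedge (\<lambda>x. 0) (\<lambda>x. 0) = (\<lambda>x xs. 0)"
    by (rule bivector_eqI[OF section_wedge_mv_sections])
      (auto simp: sections_zero section_wedge_eval mv_sectionsI smooth_fun_on_const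
        dual_space_zero_arg[OF _ subspace_0[OF subspace_fibre]])
  then show ?case
    using decomposables.wedge[OF sections_zero sections_zero] by (intro bexI[of _ "\<lambda>x xs. 0"]) auto
next
  case (Suc n)
  then obtain Q where Q: "Q \<in> decomposables" "\<forall>x xs. Q x xs = (\<Sum>i<n. section_wedge (X i) (Y i) x xs)"
    by force
  then have "mv_add Q (section_wedge (X n) (Y n)) \<in> decomposables"
    using Suc.prems by (intro decomposables.intros) auto
  then show ?case
    using Q(2) by (intro bexI[of _ "mv_add Q (section_wedge (X n) (Y n))"]) (auto simp: mv_add_def)
qed

text \<open>In a frame, \<open>g P = \<Sum>\<^sub>i X\<^sub>i \<and> P\<theta>\<^sub>i / 2\<close>.\<close>

lemma bivector_decomposition:
  assumes P: "P \<in> mv_sections A 2"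
  obtains g where "g \<in> smooth_functions A" "g x \<noteq> 0" "wedge (mv_of_fun g) P \<in> decomposables"
proof -
  obtain g X \<theta> where g: "g \<in> smooth_functions A" "g x \<noteq> 0"
    and X\<theta>: "\<forall>i<rank A. X i \<in> sections A \<and> \<theta> i \<in> dual_sections A"
    and expand: "\<forall>y. \<forall>v\<in>fibre A y. g y *\<^sub>R v = (\<Sum>i<rank A. \<theta> i y v *\<^sub>R X i y)"
    using global_frame[of x] .
  \<comment> \<open>The factor 1/2 is due to antisymmetry: the sum of the products of
    \<open>X i\<close> with P(\<open>\<theta> i\<close>) has the value g P(\<xi>, \<eta>) - g
    P(\<eta>, \<xi>) = 2 g P(\<xi>, \<eta>).\<close>
  define Y where "Y i y = (1/2) *\<^sub>R sharp A P (\<theta> i) y" for i y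
  have X: "X i \<in> sections A" and \<theta>: "\<theta> i \<in> dual_sections A" and Y: "Y i \<in> sections A" if "i < rank A" for i
    unfolding Y_def[abs_def] using that X\<theta> sections_scale[OF sharp_sections[OF P] smooth_functions_const]
    by blast+
  obtain Q where Q: "Q \<in> decomposables" "\<forall>x xs. Q x xs = (\<Sum>i<rank A. section_wedge (X i) (Y i) x xs)"
    using sum_section_wedge_decomposable[of "rank A" X Y] X Y by blast
  have "wedge (mv_of_fun g) P = Q"
  proof (rule bivector_eqI)
    fix y \<xi> \<eta> assume \<xi>: "\<xi> \<in> dual_space (fibre A y)" and \<eta>: "\<eta> \<in> dual_space (fibre A y)"
    note Py = mv_sections_ext_power[OF P, of y]
    note \<theta>y = dual_section_in_dual_space[OF \<theta>, of _ y]
    have half: "(\<Sum>i<rank A. \<alpha> (X i y) * P y [\<theta> i y, \<beta>]) = g y * P y [\<alpha>, \<beta>]"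
      if \<alpha>: "\<alpha> \<in> dual_space (fibre A y)" and \<beta>: "\<beta> \<in> dual_space (fibre A y)" for \<alpha> \<beta>
    proof -
      \<comment> \<open>This is the dual of the vector expansion: g \<alpha> is the combination of
        the \<open>\<theta> i\<close> with coefficients \<alpha>(\<open>X i\<close>). The summand
        \<open>0 * \<alpha> v\<close> gives it the shape of a two-term linear combination.\<close>
      have *: "(\<lambda>v. \<Sum>i<rank A. \<alpha> (X i y) * \<theta> i y v) = (\<lambda>v. g y * \<alpha> v + 0 * \<alpha> v)"
      proof
        fix v
        show "(\<Sum>i<rank A. \<alpha> (X i y) * \<theta> i y v) = g y * \<alpha> v + 0 * \<alpha> v"
        proof (cases "v \<in> fibre A y")
          case True
          have "g y * \<alpha> v = \<alpha> (\<Sum>i<rank A. \<theta> i y v *\<^sub>R X i y)"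
            using expand True dual_space_scaleR[OF \<alpha> True, of "g y"] by simp
          also have "\<dots> = (\<Sum>i<rank A. \<theta> i y v * \<alpha> (X i y))"
            using X section_in_fibre by (intro dual_space_sum_arg[OF \<alpha> subspace_fibre]) auto
          finally show ?thesis
            by (simp add: mult.commute)
        next
          case False
          then show ?thesis
            using \<theta>y \<alpha> by (simp add: dual_space_def)
        qed
      qed
      have "g y * P y [\<alpha>, \<beta>] = - (g y * P y [\<beta>, \<alpha>] + 0 * P y [\<beta>, \<alpha>])"
        using bivector_antisym[OF Py \<alpha> \<beta>] by simp
      also have "\<dots> = - P y [\<beta>, \<lambda>v. g y * \<alpha> v + 0 * \<alpha> v]"
        by (simp only: bivector_linear_right[OF Py \<alpha> \<alpha> \<beta>])
      also have "\<dots> = - (\<Sum>i<rank A. \<alpha> (X i y) * P y [\<beta>, \<theta> i y])"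
        unfolding *[symmetric] using \<theta>y by (subst bivector_sum_right[OF Py \<beta>]) simp_all
      also have "\<dots> = (\<Sum>i<rank A. \<alpha> (X i y) * P y [\<theta> i y, \<beta>])"
        unfolding sum_negf[symmetric]
        using bivector_antisym[OF Py \<beta> \<theta>y] by (intro sum.cong) auto
      finally show ?thesis
        by simp
    qed
    have "section_wedge (X i) (Y i) y [\<xi>, \<eta>] =
        1/2 * (\<xi> (X i y) * P y [\<theta> i y, \<eta>]) - 1/2 * (\<eta> (X i y) * P y [\<theta> i y, \<xi>])" if i: "i < rank A" for i
    proof -
      have half_Y: "\<alpha> (Y i y) = 1/2 * P y [\<theta> i y, \<alpha>]" if "\<alpha> \<in> dual_space (fibre A y)" for \<alpha>
        unfolding Y_def using dual_space_scaleR[OF that sharp_in_fibre[OF P \<theta>[OF i]]]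
          sharp_eval[OF P \<theta>[OF i] that] by simp
      show ?thesis
        unfolding section_wedge_eval[OF X[OF i] Y[OF i] \<xi> \<eta>] half_Y[OF \<xi>] half_Y[OF \<eta>] by simp
    qed
    then have "Q y [\<xi>, \<eta>] = (\<Sum>i<rank A. 1/2 * (\<xi> (X i y) * P y [\<theta> i y, \<eta>])
        - 1/2 * (\<eta> (X i y) * P y [\<theta> i y, \<xi>]))"
      using Q(2) by simp
    also have "\<dots> = 1/2 * (g y * P y [\<xi>, \<eta>]) - 1/2 * (g y * P y [\<eta>, \<xi>])"
      unfolding sum_subtractf sum_distrib_left[symmetric] half[OF \<xi> \<eta>] half[OF \<eta> \<xi>] ..
    also have "\<dots> = g y * P y [\<xi>, \<eta>]"
      using bivector_antisym[OF Py \<xi> \<eta>] by simp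
    finally show "wedge (mv_of_fun g) P y [\<xi>, \<eta>] = Q y [\<xi>, \<eta>]"
      by (simp add: wedge_fun_left)
  qed (use fun_wedge_mv_sections[OF g(1) P] decomposables_mv_sections[OF Q(1)] in simp_all)
  then show ?thesis
    using that[OF g] Q(1) by simp
qed

end


section \<open>Lie algebroids\<close>

locale smooth_algebroid =
  fixes A :: "('m::{t2_space,second_countable_topology}, 'e::real_inner, 'v::real_vector, 'z) algebroid_scheme"
  assumes algebroid: "lie_algebroid A"

sublocale smooth_algebroid \<subseteq> smooth_bundle A
  using algebroid by unfold_locales (simp add: lie_algebroid_def)

text \<open>For \<open>P = Q\<close> this is half of \<open>[P, P](\<xi>, \<eta>, \<zeta>)\<close>, written without Lie derivatives of forms.\<close>

definition sharp_jacobi ::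
  "('m, 'e::real_inner, 'v::real_vector, 'z) algebroid_scheme \<Rightarrow> ('m, 'v) mvfield \<Rightarrow> ('m, 'v) mvfield \<Rightarrow>
     ('m \<Rightarrow> 'v \<Rightarrow> real) \<Rightarrow> ('m \<Rightarrow> 'v \<Rightarrow> real) \<Rightarrow> ('m \<Rightarrow> 'v \<Rightarrow> real) \<Rightarrow> 'm \<Rightarrow> real" where
  "sharp_jacobi A P Q \<xi> \<eta> \<zeta> x =
     pairing \<xi> (bracket A (sharp A P \<eta>) (sharp A Q \<zeta>)) x +
     pairing \<eta> (bracket A (sharp A P \<zeta>) (sharp A Q \<xi>)) x +
     pairing \<zeta> (bracket A (sharp A P \<xi>) (sharp A Q \<eta>)) x +
     act A (sharp A P \<xi>) (pairing \<eta> (sharp A Q \<zeta>)) x +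
     act A (sharp A P \<eta>) (pairing \<zeta> (sharp A Q \<xi>)) x +
     act A (sharp A P \<zeta>) (pairing \<xi> (sharp A Q \<eta>)) x"

context smooth_algebroid
begin

lemma anchor: "bundle_anchor A"
  using algebroid by (simp add: lie_algebroid_def)

lemma lie_bracket: "lie_bracket_on_sections A"
  using algebroid by (simp add: lie_algebroid_def)

lemma anchor_tangent: "X \<in> sections A \<Longrightarrow> anchor A x (X x) \<in> tangent_space A x"
  using anchor section_in_fibre[of X x] by (simp add: bundle_anchor_def)

lemma act_combine_fun:
  assumes "X \<in> sections A" "f \<in> smooth_functions A" "g \<in> smooth_functions A"
  shows "act A X (\<lambda>x. a * f x + b * g x) x = a * act A X f x + b * act A X g x"
  using anchor_tangent[OF assms(1), of x] assms(2,3) by (simp add: tangent_space_def act_def)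

lemma act_mult:
  assumes "X \<in> sections A" "f \<in> smooth_functions A" "g \<in> smooth_functions A"
  shows "act A X (\<lambda>x. f x * g x) x = act A X f x * g x + f x * act A X g x"
  using anchor_tangent[OF assms(1), of x] assms(2,3) by (simp add: tangent_space_def act_def)

lemma act_add_fun:
  assumes "X \<in> sections A" "f \<in> smooth_functions A" "g \<in> smooth_functions A"
  shows "act A X (\<lambda>x. f x + g x) x = act A X f x + act A X g x"
  using act_combine_fun[OF assms, of 1 1] by simp

lemma act_minus_fun:
  assumes "X \<in> sections A" "f \<in> smooth_functions A"
  shows "act A X (\<lambda>x. - f x) x = - act A X f x"
  using act_combine_fun[OF assms assms(2), of "-1" 0] by simp

lemma act_combine_section:
  assumes "X \<in> sections A" "Y \<in> sections A"
  shows "act A (\<lambda>x. f x *\<^sub>R X x + g x *\<^sub>R Y x) h x = f x * act A X h x + g x * act A Y h x"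
  using anchor section_in_fibre[OF assms(1)] section_in_fibre[OF assms(2)]
  by (simp add: bundle_anchor_def act_def)

lemma act_add_section:
  assumes "X \<in> sections A" "Y \<in> sections A"
  shows "act A (\<lambda>x. X x + Y x) h x = act A X h x + act A Y h x"
  using act_combine_section[OF assms, of "\<lambda>x. 1" "\<lambda>x. 1"] by simp

lemma act_scale_section:
  assumes "X \<in> sections A"
  shows "act A (\<lambda>x. f x *\<^sub>R X x) h x = f x * act A X h x"
  using act_combine_section[OF assms assms, of f "\<lambda>x. 0"] by simp

lemma bracket_sections:
  assumes "X \<in> sections A" "Y \<in> sections A"
  shows "bracket A X Y \<in> sections A"
proof -
  have "\<forall>X\<in>sections A. \<forall>Y\<in>sections A. bracket A X Y \<in> sections A"
    using lie_bracket unfolding lie_bracket_on_sections_def by (elim conjE)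
  from this[rule_format, OF assms] show ?thesis .
qed

lemma bracket_antisym:
  assumes "X \<in> sections A" "Y \<in> sections A"
  shows "bracket A X Y = (\<lambda>x. - bracket A Y X x)"
proof -
  have "\<forall>X\<in>sections A. \<forall>Y\<in>sections A. bracket A X Y = (\<lambda>x. - bracket A Y X x)"
    using lie_bracket unfolding lie_bracket_on_sections_def by (elim conjE)
  from this[rule_format, OF assms] show ?thesis .
qed

lemma bracket_add_right:
  assumes "X \<in> sections A" "Y \<in> sections A" "Z \<in> sections A"
  shows "bracket A X (\<lambda>x. Y x + Z x) = (\<lambda>x. bracket A X Y x + bracket A X Z x)"
proof -
  have "\<forall>X\<in>sections A. \<forall>Y\<in>sections A. \<forall>Z\<in>sections A. \<forall>a b.
      bracket A X (\<lambda>x. a *\<^sub>R Y x + b *\<^sub>R Z x) = (\<lambda>x. a *\<^sub>R bracket A X Y x + b *\<^sub>R bracket A X Z x)"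
    using lie_bracket unfolding lie_bracket_on_sections_def by (elim conjE)
  from this[rule_format, OF assms, of 1 1] show ?thesis
    by simp
qed

lemma bracket_scale_right:
  assumes "X \<in> sections A" "Y \<in> sections A" "f \<in> smooth_functions A"
  shows "bracket A X (\<lambda>x. f x *\<^sub>R Y x) = (\<lambda>x. f x *\<^sub>R bracket A X Y x + act A X f x *\<^sub>R Y x)"
proof -
  have "\<forall>X\<in>sections A. \<forall>Y\<in>sections A. \<forall>f\<in>smooth_functions A.
      bracket A X (\<lambda>x. f x *\<^sub>R Y x) = (\<lambda>x. f x *\<^sub>R bracket A X Y x + act A X f x *\<^sub>R Y x)"
    using algebroid unfolding lie_algebroid_def by (elim conjE)
  from this[rule_format, OF assms] show ?thesis .
qed

section \<open>Brackets of sections paired with a form\<close>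

lemma pairing_combine:
  assumes "\<xi> \<in> dual_sections A" "X \<in> sections A" "Y \<in> sections A"
  shows "pairing \<xi> (\<lambda>x. f x *\<^sub>R X x + g x *\<^sub>R Y x) x = f x * pairing \<xi> X x + g x * pairing \<xi> Y x"
  unfolding pairing_def
  by (rule dual_space_linear[OF dual_section_in_dual_space[OF assms(1)] section_in_fibre[OF assms(2)]
        section_in_fibre[OF assms(3)]])

lemma pairing_add:
  assumes "\<xi> \<in> dual_sections A" "X \<in> sections A" "Y \<in> sections A"
  shows "pairing \<xi> (\<lambda>x. X x + Y x) x = pairing \<xi> X x + pairing \<xi> Y x"
  using pairing_combine[OF assms, of "\<lambda>x. 1" "\<lambda>x. 1"] by simp

lemma pairing_scale:
  assumes "\<xi> \<in> dual_sections A" "X \<in> sections A"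
  shows "pairing \<xi> (\<lambda>x. f x *\<^sub>R X x) x = f x * pairing \<xi> X x"
  using pairing_combine[OF assms assms(2), of f "\<lambda>x. 0"] by simp

lemma pairing_bracket_antisym:
  assumes "\<xi> \<in> dual_sections A" "X \<in> sections A" "Y \<in> sections A"
  shows "pairing \<xi> (bracket A X Y) x = - pairing \<xi> (bracket A Y X) x"
  unfolding bracket_antisym[OF assms(2,3)]
  using pairing_scale[OF assms(1) bracket_sections[OF assms(3,2)], of "\<lambda>x. -1"] by simp

lemma pairing_bracket_add_right:
  assumes "\<xi> \<in> dual_sections A" "X \<in> sections A" "Y \<in> sections A" "Z \<in> sections A"
  shows "pairing \<xi> (bracket A X (\<lambda>x. Y x + Z x)) x = pairing \<xi> (bracket A X Y) x + pairing \<xi> (bracket A X Z) x"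
  unfolding bracket_add_right[OF assms(2-4)] using assms by (intro pairing_add bracket_sections)

lemma pairing_bracket_add_left:
  assumes "\<xi> \<in> dual_sections A" "X \<in> sections A" "Y \<in> sections A" "Z \<in> sections A"
  shows "pairing \<xi> (bracket A (\<lambda>x. Y x + Z x) X) x = pairing \<xi> (bracket A Y X) x + pairing \<xi> (bracket A Z X) x"
  using pairing_bracket_antisym[OF assms(1) sections_add[OF assms(3,4)] assms(2)]
    pairing_bracket_antisym[OF assms(1,3,2)] pairing_bracket_antisym[OF assms(1,4,2)]
    pairing_bracket_add_right[OF assms] by simp

lemma pairing_bracket_scale_right:
  assumes "\<xi> \<in> dual_sections A" "X \<in> sections A" "Y \<in> sections A" "f \<in> smooth_functions A"
  shows "pairing \<xi> (bracket A X (\<lambda>x. f x *\<^sub>R Y x)) x =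
    f x * pairing \<xi> (bracket A X Y) x + act A X f x * pairing \<xi> Y x"
  unfolding bracket_scale_right[OF assms(2-4)]
  using assms by (intro pairing_combine bracket_sections)

lemma pairing_bracket_scale:
  assumes \<xi>: "\<xi> \<in> dual_sections A" and X: "X \<in> sections A" and Y: "Y \<in> sections A"
    and f: "f \<in> smooth_functions A" and g: "g \<in> smooth_functions A"
  shows "pairing \<xi> (bracket A (\<lambda>x. f x *\<^sub>R X x) (\<lambda>x. g x *\<^sub>R Y x)) x =
    f x * g x * pairing \<xi> (bracket A X Y) x + f x * act A X g x * pairing \<xi> Y x
      - g x * act A Y f x * pairing \<xi> X x"
proof -
  note fX = sections_scale[OF X f]
  have "pairing \<xi> (bracket A (\<lambda>x. f x *\<^sub>R X x) Y) x = - pairing \<xi> (bracket A Y (\<lambda>x. f x *\<^sub>R X x)) x"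
    by (rule pairing_bracket_antisym[OF \<xi> fX Y])
  also have "\<dots> = f x * pairing \<xi> (bracket A X Y) x - act A Y f x * pairing \<xi> X x"
    using pairing_bracket_scale_right[OF \<xi> Y X f] pairing_bracket_antisym[OF \<xi> Y X] by simp
  finally have left: "pairing \<xi> (bracket A (\<lambda>x. f x *\<^sub>R X x) Y) x =
      f x * pairing \<xi> (bracket A X Y) x - act A Y f x * pairing \<xi> X x" .
  show ?thesis
    by (simp add: pairing_bracket_scale_right[OF \<xi> fX Y g] act_scale_section[OF X] left algebra_simps)
qed

text \<open>The shape is that of the images of two forms under products of sections: by
  \<open>sharp_section_wedge\<close> each image is a combination of two sections with function
  coefficients.\<close>

lemma pairing_bracket_combine:
  assumes \<xi>: "\<xi> \<in> dual_sections A"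
    and sec: "X \<in> sections A" "Y \<in> sections A" "Z \<in> sections A" "W \<in> sections A"
    and smooth: "f \<in> smooth_functions A" "g \<in> smooth_functions A" "h \<in> smooth_functions A" "k \<in> smooth_functions A"
  shows "pairing \<xi> (bracket A (\<lambda>x. f x *\<^sub>R X x + g x *\<^sub>R Y x) (\<lambda>x. h x *\<^sub>R Z x + k x *\<^sub>R W x)) x =
    (f x * h x * pairing \<xi> (bracket A X Z) x + f x * act A X h x * pairing \<xi> Z x
      - h x * act A Z f x * pairing \<xi> X x) +
    (f x * k x * pairing \<xi> (bracket A X W) x + f x * act A X k x * pairing \<xi> W x
      - k x * act A W f x * pairing \<xi> X x) +
    (g x * h x * pairing \<xi> (bracket A Y Z) x + g x * act A Y h x * pairing \<xi> Z x
      - h x * act A Z g x * pairing \<xi> Y x) +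
    (g x * k x * pairing \<xi> (bracket A Y W) x + g x * act A Y k x * pairing \<xi> W x
      - k x * act A W g x * pairing \<xi> Y x)"
  by (simp add: pairing_bracket_add_left pairing_bracket_add_right pairing_bracket_scale sections_add
      sections_scale \<xi> sec smooth)

text \<open>Together with additivity in the second bivector this serves twice: in the induction over
  sums of products, and in the polarisation that yields the mixed identity of a Hamiltonian
  pair.\<close>

lemma sharp_jacobi_add_left:
  assumes P: "P \<in> mv_sections A 2" and P': "P' \<in> mv_sections A 2" and Q: "Q \<in> mv_sections A 2"
    and \<xi>: "\<xi> \<in> dual_sections A" and \<eta>: "\<eta> \<in> dual_sections A" and \<zeta>: "\<zeta> \<in> dual_sections A"
  shows "sharp_jacobi A (mv_add P P') Q \<xi> \<eta> \<zeta> x = sharp_jacobi A P Q \<xi> \<eta> \<zeta> x + sharp_jacobi A P' Q \<xi> \<eta> \<zeta> x"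
  unfolding sharp_jacobi_def sharp_add[OF P P' \<xi>] sharp_add[OF P P' \<eta>] sharp_add[OF P P' \<zeta>]
  using assms by (simp add: pairing_bracket_add_left act_add_section sharp_sections)

lemma sharp_jacobi_add_right:
  assumes Q: "Q \<in> mv_sections A 2" and Q': "Q' \<in> mv_sections A 2" and P: "P \<in> mv_sections A 2"
    and \<xi>: "\<xi> \<in> dual_sections A" and \<eta>: "\<eta> \<in> dual_sections A" and \<zeta>: "\<zeta> \<in> dual_sections A"
  shows "sharp_jacobi A P (mv_add Q Q') \<xi> \<eta> \<zeta> x = sharp_jacobi A P Q \<xi> \<eta> \<zeta> x + sharp_jacobi A P Q' \<xi> \<eta> \<zeta> x"
proof -
  have "pairing \<alpha> (\<lambda>x. sharp A Q \<beta> x + sharp A Q' \<beta> x) =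
      (\<lambda>x. pairing \<alpha> (sharp A Q \<beta>) x + pairing \<alpha> (sharp A Q' \<beta>) x)"
    if "\<alpha> \<in> dual_sections A" "\<beta> \<in> dual_sections A" for \<alpha> \<beta>
    using that Q Q' by (intro ext pairing_add sharp_sections)
  then show ?thesis
    unfolding sharp_jacobi_def sharp_add[OF Q Q' \<xi>] sharp_add[OF Q Q' \<eta>] sharp_add[OF Q Q' \<zeta>]
    using assms by (simp add: pairing_bracket_add_right act_add_fun sharp_sections pairing_smooth)
qed

text \<open>For each of the three derivatives of \<open>g\<close>, for instance the one along
  P\<xi>, two bracket terms contribute g (P\<xi>)(g) P(\<eta>, \<zeta>) each and one anchor term
  contributes its negative. Exactly one copy is left.\<close>

lemma sharp_jacobi_scale:
  assumes g: "g \<in> smooth_functions A" and P: "P \<in> mv_sections A 2"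
    and \<xi>: "\<xi> \<in> dual_sections A" and \<eta>: "\<eta> \<in> dual_sections A" and \<zeta>: "\<zeta> \<in> dual_sections A"
  shows "sharp_jacobi A (wedge (mv_of_fun g) P) (wedge (mv_of_fun g) P) \<xi> \<eta> \<zeta> x =
    g x * g x * sharp_jacobi A P P \<xi> \<eta> \<zeta> x +
    g x * (act A (sharp A P \<xi>) g x * P x [\<eta> x, \<zeta> x] + act A (sharp A P \<eta>) g x * P x [\<zeta> x, \<xi> x]
      + act A (sharp A P \<zeta>) g x * P x [\<xi> x, \<eta> x])"
proof -
  have scale: "pairing \<alpha> (\<lambda>x. g x *\<^sub>R sharp A P \<beta> x) = (\<lambda>x. g x * pairing \<alpha> (sharp A P \<beta>) x)"
    if "\<alpha> \<in> dual_sections A" "\<beta> \<in> dual_sections A" for \<alpha> \<beta>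
    using that P by (intro ext pairing_scale sharp_sections)
  have anti: "P x [\<beta> x, \<alpha> x] = - P x [\<alpha> x, \<beta> x]"
    if "\<alpha> \<in> dual_sections A" "\<beta> \<in> dual_sections A" for \<alpha> \<beta>
    using that by (intro bivector_antisym[OF mv_sections_ext_power[OF P]] dual_section_in_dual_space)
  show ?thesis
    unfolding sharp_jacobi_def sharp_scale[OF P \<xi>] sharp_scale[OF P \<eta>] sharp_scale[OF P \<zeta>]
    using assms
    by (simp add: scale pairing_bracket_scale act_scale_section act_mult sharp_sections pairing_smooth)
      (simp add: pairing_sharp[OF P, where x = x] \<xi> \<eta> \<zeta> anti[OF \<xi> \<eta>] anti[OF \<eta> \<zeta>] anti[OF \<xi> \<zeta>] algebra_simps)
qed

end


section \<open>The Schouten bracket of bivectors\<close>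

locale schouten_algebroid = smooth_algebroid A
  for A :: "('m::{t2_space,second_countable_topology}, 'e::real_inner, 'v::real_vector, 'z) algebroid_scheme" +
  fixes S :: "('m, 'v) mvfield \<Rightarrow> ('m, 'v) mvfield \<Rightarrow> ('m, 'v) mvfield"
  assumes schouten: "schouten_bracket A S"
begin

lemma schouten_degree:
  assumes "P \<in> mv_sections A p" "Q \<in> mv_sections A q" "p + q \<noteq> 0"
  shows "S P Q \<in> mv_sections A (p + q - 1)"
proof -
  have "\<forall>p q. \<forall>P\<in>mv_sections A p. \<forall>Q\<in>mv_sections A q.
      if p + q = 0 then S P Q = mv_zero else S P Q \<in> mv_sections A (p + q - 1)"
    using schouten unfolding schouten_bracket_def by (elim conjE)
  from this[rule_format, OF assms(1,2)] show ?thesis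
    using assms(3) by (simp split: if_splits)
qed

lemma schouten_fun_fun:
  assumes "f \<in> smooth_functions A" "g \<in> smooth_functions A"
  shows "S (mv_of_fun f) (mv_of_fun g) = mv_zero"
proof -
  have "\<forall>p q. \<forall>P\<in>mv_sections A p. \<forall>Q\<in>mv_sections A q.
      if p + q = 0 then S P Q = mv_zero else S P Q \<in> mv_sections A (p + q - 1)"
    using schouten unfolding schouten_bracket_def by (elim conjE)
  from this[rule_format, OF mv_of_fun_mv_sections[OF assms(1)] mv_of_fun_mv_sections[OF assms(2)]]
  show ?thesis
    by simp
qed

lemma schouten_add:
  assumes "P \<in> mv_sections A p" "Q \<in> mv_sections A q" "R \<in> mv_sections A q"
  shows "S P (mv_add Q R) = mv_add (S P Q) (S P R)"
proof -
  have "\<forall>p q. \<forall>P\<in>mv_sections A p. \<forall>Q\<in>mv_sections A q. \<forall>R\<in>mv_sections A q. \<forall>a b.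
      S P (mv_add (mv_scale a Q) (mv_scale b R)) = mv_add (mv_scale a (S P Q)) (mv_scale b (S P R))"
    using schouten unfolding schouten_bracket_def by (elim conjE)
  from this[rule_format, OF assms, of 1 1] show ?thesis
    by (simp add: mv_scale_def)
qed

lemma schouten_swap:
  assumes "P \<in> mv_sections A p" "Q \<in> mv_sections A q"
  shows "S P Q = mv_scale (- ((-1) ^ ((p + 1) * (q + 1)))) (S Q P)"
proof -
  have "\<forall>p q. \<forall>P\<in>mv_sections A p. \<forall>Q\<in>mv_sections A q.
      S P Q = mv_scale (- ((-1) ^ ((p + 1) * (q + 1)))) (S Q P)"
    using schouten unfolding schouten_bracket_def by (elim conjE)
  from this[rule_format, OF assms] show ?thesis .
qed

lemma schouten_wedge:
  assumes "P \<in> mv_sections A p" "Q \<in> mv_sections A q" "R \<in> mv_sections A r"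
  shows "S P (wedge Q R) =
    mv_add (wedge (S P Q) R) (mv_scale ((-1) ^ ((p + 1) * q)) (wedge Q (S P R)))"
proof -
  have "\<forall>p q r. \<forall>P\<in>mv_sections A p. \<forall>Q\<in>mv_sections A q. \<forall>R\<in>mv_sections A r.
      S P (wedge Q R) = mv_add (wedge (S P Q) R) (mv_scale ((-1) ^ ((p + 1) * q)) (wedge Q (S P R)))"
    using schouten unfolding schouten_bracket_def by (elim conjE)
  from this[rule_format, OF assms] show ?thesis .
qed

lemma schouten_section_fun:
  assumes "X \<in> sections A" "f \<in> smooth_functions A"
  shows "S (mv_of_section A X) (mv_of_fun f) = mv_of_fun (act A X f)"
proof -
  have "\<forall>X\<in>sections A. \<forall>f\<in>smooth_functions A.
      S (mv_of_section A X) (mv_of_fun f) = mv_of_fun (act A X f)"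
    using schouten unfolding schouten_bracket_def by (elim conjE)
  from this[rule_format, OF assms] show ?thesis .
qed

lemma schouten_section_section:
  assumes "X \<in> sections A" "Y \<in> sections A"
  shows "S (mv_of_section A X) (mv_of_section A Y) = mv_of_section A (bracket A X Y)"
proof -
  have "\<forall>X\<in>sections A. \<forall>Y\<in>sections A.
      S (mv_of_section A X) (mv_of_section A Y) = mv_of_section A (bracket A X Y)"
    using schouten unfolding schouten_bracket_def by (elim conjE)
  from this[rule_format, OF assms] show ?thesis .
qed

text \<open>In degrees 2 and 2 the sign is -(-1)^9 = 1.\<close>

lemma schouten_bivector_commute:
  assumes "P \<in> mv_sections A 2" "Q \<in> mv_sections A 2"
  shows "S P Q = S Q P"
  using schouten_swap[OF assms] by (simp add: mv_scale_def)

lemma mv_of_section_pairing: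
  "\<xi> \<in> dual_sections A \<Longrightarrow> mv_of_section A X x [\<xi> x] = pairing \<xi> X x"
  by (simp add: mv_of_section_eval dual_section_in_dual_space pairing_def)

lemma section_wedge_pairing:
  assumes "X \<in> sections A" "Y \<in> sections A" "\<xi> \<in> dual_sections A" "\<eta> \<in> dual_sections A"
  shows "section_wedge X Y x [\<xi> x, \<eta> x] = pairing \<xi> X x * pairing \<eta> Y x - pairing \<eta> X x * pairing \<xi> Y x"
  using section_wedge_eval[OF assms(1,2) dual_section_in_dual_space[OF assms(3)]
      dual_section_in_dual_space[OF assms(4)]] by (simp add: pairing_def)

text \<open>For a product, the Leibniz rule and [f, X] = -X(f) give [f, X \<and> Y] = Y(f) X - X(f)
  Y; paired with \<xi> this is the derivative of \<open>f\<close> along \<langle>\<xi>,X\<rangle> Y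
  - \<langle>\<xi>,Y\<rangle> X.\<close>

lemma schouten_fun_decomposable:
  assumes f: "f \<in> smooth_functions A" and "P \<in> decomposables" and \<xi>: "\<xi> \<in> dual_sections A"
  shows "S (mv_of_fun f) P x [\<xi> x] = act A (sharp A P \<xi>) f x"
  using assms(2)
proof induction
  case (wedge X Y)
  note F = mv_of_fun_mv_sections[OF f]
    and X = mv_of_section_mv_sections[OF wedge(1)] and Y = mv_of_section_mv_sections[OF wedge(2)]
  have "S (mv_of_fun f) (mv_of_section A Z) = mv_of_fun (\<lambda>x. - act A Z f x)" if "Z \<in> sections A" for Z
    using schouten_swap[OF F mv_of_section_mv_sections[OF that]] schouten_section_fun[OF that f]
    by (auto simp: mv_scale_def mv_of_fun_def fun_eq_iff)
  moreover have "act A (sharp A (section_wedge X Y) \<xi>) f x =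
      pairing \<xi> X x * act A Y f x + (- pairing \<xi> Y x) * act A X f x"
    unfolding sharp_section_wedge[OF wedge \<xi>] by (rule act_combine_section[OF wedge(2,1)])
  ultimately show ?case
    using schouten_wedge[OF F X Y] wedge \<xi>
    by (simp add: mv_add_def mv_scale_def wedge_fun_left wedge_fun_right_1 mv_of_section_pairing)
next
  case (add P Q)
  note P = decomposables_mv_sections[OF add(1)] and Q = decomposables_mv_sections[OF add(2)]
  show ?case
    using add.IH schouten_add[OF mv_of_fun_mv_sections[OF f] P Q] sharp_add[OF P Q \<xi>]
      act_add_section[OF sharp_sections[OF P \<xi>] sharp_sections[OF Q \<xi>]]
    by (simp add: mv_add_def)
qed

text \<open>Because [f, g] = 0, the Leibniz rule gives [f, g P] = g [f, P] without derivatives of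
  \<open>g\<close>. Both sides are multiplied by \<open>g\<close>, and the factor is cancelled at
  x.\<close>

lemma schouten_fun_bivector:
  assumes f: "f \<in> smooth_functions A" and P: "P \<in> mv_sections A 2" and \<xi>: "\<xi> \<in> dual_sections A"
  shows "S (mv_of_fun f) P x [\<xi> x] = act A (sharp A P \<xi>) f x"
proof -
  obtain g where g: "g \<in> smooth_functions A" "g x \<noteq> 0" "wedge (mv_of_fun g) P \<in> decomposables"
    using bivector_decomposition[OF P] .
  have "wedge mv_zero P x [\<xi> x] = 0"
    by (simp add: wedge_def mv_zero_def)
  then have "S (mv_of_fun f) (wedge (mv_of_fun g) P) x [\<xi> x] = g x * S (mv_of_fun f) P x [\<xi> x]"
    using schouten_wedge[OF mv_of_fun_mv_sections[OF f] mv_of_fun_mv_sections[OF g(1)] P]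
      schouten_fun_fun[OF f g(1)]
    by (simp add: mv_add_def mv_scale_def wedge_fun_left)
  moreover have "S (mv_of_fun f) (wedge (mv_of_fun g) P) x [\<xi> x] = g x * act A (sharp A P \<xi>) f x"
    using schouten_fun_decomposable[OF f g(3) \<xi>] sharp_scale[OF P \<xi>]
      act_scale_section[OF sharp_sections[OF P \<xi>]] by simp
  ultimately show ?thesis
    using g(2) by simp
qed

text \<open>In degrees 2 and 0 the swap has sign -(-1)^3 = 1, so the order of the arguments does not
  matter.\<close>

lemma schouten_bivector_fun:
  assumes "f \<in> smooth_functions A" "P \<in> mv_sections A 2" "\<xi> \<in> dual_sections A"
  shows "S P (mv_of_fun f) x [\<xi> x] = act A (sharp A P \<xi>) f x"
  using schouten_fun_bivector[OF assms] schouten_swap[OF assms(2) mv_of_fun_mv_sections[OF assms(1)]]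
  by (simp add: mv_scale_def)

text \<open>The left side expands into brackets of sections only, whereas the right side also
  contains derivatives of pairings. In a single \<open>sharp_jacobi\<close> these do not all cancel:
  what remains of the derivatives along one bivector is cancelled by the term with the two bivectors
  exchanged. Hence the symmetrised form.\<close>

lemma schouten_section_wedge_section_wedge:
  assumes X: "X \<in> sections A" and Y: "Y \<in> sections A" and Z: "Z \<in> sections A" and W: "W \<in> sections A"
    and \<xi>: "\<xi> \<in> dual_sections A" and \<eta>: "\<eta> \<in> dual_sections A" and \<zeta>: "\<zeta> \<in> dual_sections A"
  shows "S (section_wedge Z W) (section_wedge X Y) x [\<xi> x, \<eta> x, \<zeta> x] =
    sharp_jacobi A (section_wedge Z W) (section_wedge X Y) \<xi> \<eta> \<zeta> x +
    sharp_jacobi A (section_wedge X Y) (section_wedge Z W) \<xi> \<eta> \<zeta> x"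
proof -
  let ?P = "section_wedge Z W"
  note P = section_wedge_mv_sections[OF Z W]
  have PV: "S ?P (mv_of_section A V) \<in> mv_sections A 2" if "V \<in> sections A" for V
    using schouten_degree[OF P mv_of_section_mv_sections[OF that]] by simp
  \<comment> \<open>Antisymmetry and the Leibniz rule give [Z \<and> W, V] = -[V, Z] \<and> W - Z
    \<and> [V, W].\<close>
  have eval: "S ?P (mv_of_section A V) x [\<alpha> x, \<beta> x] =
      - (pairing \<alpha> (bracket A V Z) x * pairing \<beta> W x - pairing \<beta> (bracket A V Z) x * pairing \<alpha> W x)
      - (pairing \<alpha> Z x * pairing \<beta> (bracket A V W) x - pairing \<beta> Z x * pairing \<alpha> (bracket A V W) x)"
    if V: "V \<in> sections A" and \<alpha>: "\<alpha> \<in> dual_sections A" and \<beta>: "\<beta> \<in> dual_sections A" for V \<alpha> \<beta>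
  proof -
    have "S ?P (mv_of_section A V) x [\<alpha> x, \<beta> x] = - S (mv_of_section A V) ?P x [\<alpha> x, \<beta> x]"
      using schouten_swap[OF P mv_of_section_mv_sections[OF V]] by (simp add: mv_scale_def)
    also have "S (mv_of_section A V) ?P x [\<alpha> x, \<beta> x] =
        section_wedge (bracket A V Z) W x [\<alpha> x, \<beta> x] + section_wedge Z (bracket A V W) x [\<alpha> x, \<beta> x]"
      using schouten_wedge[OF mv_of_section_mv_sections[OF V] mv_of_section_mv_sections[OF Z]
          mv_of_section_mv_sections[OF W]] schouten_section_section[OF V Z] schouten_section_section[OF V W]
      by (simp add: mv_add_def mv_scale_def)
    finally show ?thesis
      using bracket_sections[OF V Z] bracket_sections[OF V W] Z W \<alpha> \<beta>
      by (simp add: section_wedge_pairing)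
  qed
  have "S ?P (section_wedge X Y) x [\<xi> x, \<eta> x, \<zeta> x] =
      wedge (S ?P (mv_of_section A X)) (mv_of_section A Y) x [\<xi> x, \<eta> x, \<zeta> x]
      - wedge (mv_of_section A X) (S ?P (mv_of_section A Y)) x [\<xi> x, \<eta> x, \<zeta> x]"
    using schouten_wedge[OF P mv_of_section_mv_sections[OF X] mv_of_section_mv_sections[OF Y]]
    by (simp add: mv_add_def mv_scale_def)
  also have "wedge (S ?P (mv_of_section A X)) (mv_of_section A Y) x [\<xi> x, \<eta> x, \<zeta> x] =
      S ?P (mv_of_section A X) x [\<xi> x, \<eta> x] * pairing \<zeta> Y x
      - S ?P (mv_of_section A X) x [\<xi> x, \<zeta> x] * pairing \<eta> Y x
      + S ?P (mv_of_section A X) x [\<eta> x, \<zeta> x] * pairing \<xi> Y x"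
    by (simp add: wedge_bivector_left[OF PV[OF X] mv_of_section_mv_sections[OF Y]]
        mv_of_section_pairing \<xi> \<eta> \<zeta>)
  also have "wedge (mv_of_section A X) (S ?P (mv_of_section A Y)) x [\<xi> x, \<eta> x, \<zeta> x] =
      pairing \<xi> X x * S ?P (mv_of_section A Y) x [\<eta> x, \<zeta> x]
      - pairing \<eta> X x * S ?P (mv_of_section A Y) x [\<xi> x, \<zeta> x]
      + pairing \<zeta> X x * S ?P (mv_of_section A Y) x [\<xi> x, \<eta> x]"
    by (simp add: wedge_bivector_right[OF mv_of_section_mv_sections[OF X] PV[OF Y]]
        mv_of_section_pairing \<xi> \<eta> \<zeta>)
  finally have lhs: "S ?P (section_wedge X Y) x [\<xi> x, \<eta> x, \<zeta> x] =
      S ?P (mv_of_section A X) x [\<xi> x, \<eta> x] * pairing \<zeta> Y x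
      - S ?P (mv_of_section A X) x [\<xi> x, \<zeta> x] * pairing \<eta> Y x
      + S ?P (mv_of_section A X) x [\<eta> x, \<zeta> x] * pairing \<xi> Y x
      - (pairing \<xi> X x * S ?P (mv_of_section A Y) x [\<eta> x, \<zeta> x]
      - pairing \<eta> X x * S ?P (mv_of_section A Y) x [\<xi> x, \<zeta> x]
      + pairing \<zeta> X x * S ?P (mv_of_section A Y) x [\<xi> x, \<eta> x])" .
  have minus_smooth: "(\<lambda>x. - f x) \<in> smooth_functions A" if "f \<in> smooth_functions A" for f
    using smooth_functions_mult[OF smooth_functions_const[of "-1"] that] by simp
  have sharp: "sharp A (section_wedge U V) \<alpha> = (\<lambda>x. pairing \<alpha> U x *\<^sub>R V x + (- pairing \<alpha> V x) *\<^sub>R U x)"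
    if "U \<in> sections A" "V \<in> sections A" "\<alpha> \<in> dual_sections A" for U V \<alpha>
    using that by (rule sharp_section_wedge)
  have br: "pairing \<alpha> (bracket A (sharp A (section_wedge U V) \<beta>) (sharp A (section_wedge U' V') \<gamma>)) x =
      (pairing \<beta> U x * pairing \<gamma> U' x * pairing \<alpha> (bracket A V V') x
        + pairing \<beta> U x * act A V (pairing \<gamma> U') x * pairing \<alpha> V' x
        - pairing \<gamma> U' x * act A V' (pairing \<beta> U) x * pairing \<alpha> V x) -
      (pairing \<beta> U x * pairing \<gamma> V' x * pairing \<alpha> (bracket A V U') x
        + pairing \<beta> U x * act A V (pairing \<gamma> V') x * pairing \<alpha> U' x
        - pairing \<gamma> V' x * act A U' (pairing \<beta> U) x * pairing \<alpha> V x) -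
      (pairing \<beta> V x * pairing \<gamma> U' x * pairing \<alpha> (bracket A U V') x
        + pairing \<beta> V x * act A U (pairing \<gamma> U') x * pairing \<alpha> V' x
        - pairing \<gamma> U' x * act A V' (pairing \<beta> V) x * pairing \<alpha> U x) +
      (pairing \<beta> V x * pairing \<gamma> V' x * pairing \<alpha> (bracket A U U') x
        + pairing \<beta> V x * act A U (pairing \<gamma> V') x * pairing \<alpha> U' x
        - pairing \<gamma> V' x * act A U' (pairing \<beta> V) x * pairing \<alpha> U x)"
    if "U \<in> sections A" "V \<in> sections A" "U' \<in> sections A" "V' \<in> sections A"
      "\<alpha> \<in> dual_sections A" "\<beta> \<in> dual_sections A" "\<gamma> \<in> dual_sections A" for U V U' V' \<alpha> \<beta> \<gamma>
    unfolding sharp[OF that(1,2,6)] sharp[OF that(3,4,7)]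
    by (subst pairing_bracket_combine)
      (simp_all add: that minus_smooth pairing_smooth act_minus_fun)
  have ac: "act A (sharp A (section_wedge U V) \<alpha>) (pairing \<beta> (sharp A (section_wedge U' V') \<gamma>)) x =
      pairing \<alpha> U x * (act A V (pairing \<gamma> U') x * pairing \<beta> V' x + pairing \<gamma> U' x * act A V (pairing \<beta> V') x
        - act A V (pairing \<gamma> V') x * pairing \<beta> U' x - pairing \<gamma> V' x * act A V (pairing \<beta> U') x)
      - pairing \<alpha> V x * (act A U (pairing \<gamma> U') x * pairing \<beta> V' x + pairing \<gamma> U' x * act A U (pairing \<beta> V') x
        - act A U (pairing \<gamma> V') x * pairing \<beta> U' x - pairing \<gamma> V' x * act A U (pairing \<beta> U') x)"
    if "U \<in> sections A" "V \<in> sections A" "U' \<in> sections A" "V' \<in> sections A"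
      "\<alpha> \<in> dual_sections A" "\<beta> \<in> dual_sections A" "\<gamma> \<in> dual_sections A" for U V U' V' \<alpha> \<beta> \<gamma>
  proof -
    have pr: "pairing \<beta> (sharp A (section_wedge U' V') \<gamma>) =
        (\<lambda>x. pairing \<gamma> U' x * pairing \<beta> V' x + - (pairing \<gamma> V' x * pairing \<beta> U' x))"
      unfolding sharp[OF that(3,4,7)] by (rule ext) (simp only: pairing_combine[OF that(6,4,3)] mult_minus_left)
    have actT: "act A T (\<lambda>x. pairing \<gamma> U' x * pairing \<beta> V' x + - (pairing \<gamma> V' x * pairing \<beta> U' x)) x =
        act A T (pairing \<gamma> U') x * pairing \<beta> V' x + pairing \<gamma> U' x * act A T (pairing \<beta> V') x
        - act A T (pairing \<gamma> V') x * pairing \<beta> U' x - pairing \<gamma> V' x * act A T (pairing \<beta> U') x"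
      if T: "T \<in> sections A" for T
      using \<open>U' \<in> sections A\<close> \<open>V' \<in> sections A\<close> \<open>\<beta> \<in> dual_sections A\<close> \<open>\<gamma> \<in> dual_sections A\<close> T
      by (subst act_add_fun) (simp_all add: act_mult act_minus_fun minus_smooth pairing_smooth
          smooth_functions_mult)
    show ?thesis
      unfolding sharp[OF that(1,2,5)] pr act_combine_section[OF that(2,1)] actT[OF that(2)] actT[OF that(1)]
      by simp
  qed
  \<comment> \<open>The two \<open>sharp_jacobi\<close> terms produce brackets in opposite orders.
    All are turned into the order of \<open>eval\<close>, with the section from {X, Y}
    first.\<close>
  have anti: "pairing \<alpha> (bracket A U V) x = - pairing \<alpha> (bracket A V U) x"
    if "U \<in> {Z, W}" "V \<in> {X, Y}" "\<alpha> \<in> {\<xi>, \<eta>, \<zeta>}" for U V \<alpha>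
    using that X Y Z W \<xi> \<eta> \<zeta> by (intro pairing_bracket_antisym) auto
  show ?thesis
    unfolding lhs sharp_jacobi_def
    by (simp add: eval br ac X Y Z W \<xi> \<eta> \<zeta>, simp add: anti algebra_simps)
qed

text \<open>Two independent bivectors are needed for the induction, since the bracket of a sum with
  itself contains mixed brackets.\<close>

lemma schouten_decomposables:
  assumes "P \<in> decomposables" "Q \<in> decomposables"
    and \<xi>: "\<xi> \<in> dual_sections A" and \<eta>: "\<eta> \<in> dual_sections A" and \<zeta>: "\<zeta> \<in> dual_sections A"
  shows "S P Q x [\<xi> x, \<eta> x, \<zeta> x] = sharp_jacobi A P Q \<xi> \<eta> \<zeta> x + sharp_jacobi A Q P \<xi> \<eta> \<zeta> x"
  using assms(1,2)
proof (induction arbitrary: Q)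
  case (wedge Z W)
  note P = section_wedge_mv_sections[OF wedge(1,2)]
  from wedge(3) show ?case
  proof induction
    case (wedge X Y)
    then show ?case
      using schouten_section_wedge_section_wedge[OF _ _ \<open>Z \<in> sections A\<close> \<open>W \<in> sections A\<close> \<xi> \<eta> \<zeta>] by simp
  next
    case (add Q R)
    note Q = decomposables_mv_sections[OF add(1)] and R = decomposables_mv_sections[OF add(2)]
    show ?case
      using add.IH schouten_add[OF P Q R] sharp_jacobi_add_left[OF Q R P \<xi> \<eta> \<zeta>]
        sharp_jacobi_add_right[OF Q R P \<xi> \<eta> \<zeta>] by (simp add: mv_add_def)
  qed
next
  case (add P P')
  note P = decomposables_mv_sections[OF add(1)] and P' = decomposables_mv_sections[OF add(2)]
    and Q = decomposables_mv_sections[OF add(5)]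
  \<comment> \<open>The axioms give additivity in the second argument; symmetry of the bracket on
    bivectors transfers it to the first.\<close>
  have "S (mv_add P P') Q = mv_add (S P Q) (S P' Q)"
    using schouten_bivector_commute[OF mv_add_mv_sections[OF P P'] Q] schouten_add[OF Q P P']
      schouten_bivector_commute[OF Q P] schouten_bivector_commute[OF Q P'] by simp
  then show ?case
    using add.IH(1)[OF add(5)] add.IH(2)[OF add(5)] sharp_jacobi_add_left[OF P P' Q \<xi> \<eta> \<zeta>]
      sharp_jacobi_add_right[OF P P' Q \<xi> \<eta> \<zeta>] by (simp add: mv_add_def)
qed

lemma schouten_bivector_self:
  assumes P: "P \<in> mv_sections A 2"
    and \<xi>: "\<xi> \<in> dual_sections A" and \<eta>: "\<eta> \<in> dual_sections A" and \<zeta>: "\<zeta> \<in> dual_sections A"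
  shows "S P P x [\<xi> x, \<eta> x, \<zeta> x] = 2 * sharp_jacobi A P P \<xi> \<eta> \<zeta> x"
proof -
  obtain g where g: "g \<in> smooth_functions A" "g x \<noteq> 0" "wedge (mv_of_fun g) P \<in> decomposables"
    using bivector_decomposition[OF P] .
  let ?F = "mv_of_fun g" and ?xs = "[\<xi> x, \<eta> x, \<zeta> x]"
  let ?R = "wedge ?F P"
  \<comment> \<open>The value of [P, g] \<and> P on (\<xi>, \<eta>, \<zeta>); it collects all
    derivatives of \<open>g\<close>.\<close>
  define D where "D = act A (sharp A P \<xi>) g x * P x [\<eta> x, \<zeta> x] + act A (sharp A P \<eta>) g x * P x [\<zeta> x, \<xi> x]
      + act A (sharp A P \<zeta>) g x * P x [\<xi> x, \<eta> x]"
  note F = mv_of_fun_mv_sections[OF g(1)] and R = fun_wedge_mv_sections[OF g(1) P]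
  have leibniz: "S Q ?R x ?xs = wedge (S Q ?F) P x ?xs + g x * S Q P x ?xs" if "Q \<in> mv_sections A 2" for Q
    using schouten_wedge[OF that F P] by (simp add: mv_add_def mv_scale_def wedge_fun_left)
  have anti: "P x [\<xi> x, \<zeta> x] = - P x [\<zeta> x, \<xi> x]"
    using \<xi> \<zeta> by (intro bivector_antisym[OF mv_sections_ext_power[OF P]] dual_section_in_dual_space)
  have wedge: "wedge (S Q ?F) P x ?xs = act A (sharp A Q \<xi>) g x * P x [\<eta> x, \<zeta> x]
      + act A (sharp A Q \<eta>) g x * P x [\<zeta> x, \<xi> x] + act A (sharp A Q \<zeta>) g x * P x [\<xi> x, \<eta> x]"
    if Q: "Q \<in> mv_sections A 2" for Q
  proof -
    have "S Q ?F \<in> mv_sections A 1"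
      using schouten_degree[OF Q F] by simp
    then show ?thesis
      by (simp add: wedge_bivector_right[OF _ P] schouten_bivector_fun g(1) Q \<xi> \<eta> \<zeta> anti)
  qed
  have "wedge (S P ?F) P x ?xs = D"
    using wedge[OF P] by (simp add: D_def)
  moreover have "wedge (S ?R ?F) P x ?xs = g x * D"
    using wedge[OF R] sharp_scale[OF P] act_scale_section[OF sharp_sections[OF P]] \<xi> \<eta> \<zeta>
    by (simp add: D_def algebra_simps)
  moreover have "S ?R P = S P ?R"
    by (rule schouten_bivector_commute[OF R P])
  \<comment> \<open>The Leibniz rule is used twice: [gP, gP] = [gP, g] \<and> P + g [gP, P], and
    then [gP, P] = [P, gP] = [P, g] \<and> P + g [P, P]. The derivatives add up to 2 g D, the same
    amount as in the formula for the sum of products.\<close>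
  ultimately have "S ?R ?R x ?xs = g x * D + g x * (D + g x * S P P x ?xs)"
    using leibniz[OF R] leibniz[OF P] by simp
  moreover have "S ?R ?R x ?xs = 2 * (g x * g x * sharp_jacobi A P P \<xi> \<eta> \<zeta> x + g x * D)"
    using schouten_decomposables[OF g(3,3) \<xi> \<eta> \<zeta>] sharp_jacobi_scale[OF g(1) P \<xi> \<eta> \<zeta>]
    by (simp add: D_def)
  ultimately have "(g x * g x) * S P P x ?xs = (g x * g x) * (2 * sharp_jacobi A P P \<xi> \<eta> \<zeta> x)"
    by algebra
  then show ?thesis
    using g(2) by simp
qed

section \<open>From Poisson bivectors to the torsion of the relation\<close>

lemma poisson_sharp_jacobi:
  assumes "poisson_structure A S P" "\<xi> \<in> dual_sections A" "\<eta> \<in> dual_sections A" "\<zeta> \<in> dual_sections A"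
  shows "sharp_jacobi A P P \<xi> \<eta> \<zeta> x = 0"
  using assms schouten_bivector_self[of P \<xi> \<eta> \<zeta> x] by (simp add: poisson_structure_def mv_zero_def)

text \<open>Polarisation: by biadditivity the expression for P + Q is the sum of those for P, for Q
  and the two mixed ones, and the three diagonal ones vanish.\<close>

lemma hamiltonian_pair_sharp_jacobi:
  assumes "hamiltonian_pair A S P Q"
    and \<xi>: "\<xi> \<in> dual_sections A" and \<eta>: "\<eta> \<in> dual_sections A" and \<zeta>: "\<zeta> \<in> dual_sections A"
  shows "sharp_jacobi A P Q \<xi> \<eta> \<zeta> x + sharp_jacobi A Q P \<xi> \<eta> \<zeta> x = 0"
proof -
  have poisson: "poisson_structure A S P" "poisson_structure A S Q" "poisson_structure A S (mv_add P Q)"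
    using assms(1) by (simp_all add: hamiltonian_pair_def)
  then have P: "P \<in> mv_sections A 2" and Q: "Q \<in> mv_sections A 2"
    by (simp_all add: poisson_structure_def)
  show ?thesis
    using poisson[THEN poisson_sharp_jacobi, OF \<xi> \<eta> \<zeta>, of x] P Q \<xi> \<eta> \<zeta>
    by (simp add: sharp_jacobi_add_left sharp_jacobi_add_right mv_add_mv_sections)
qed

end

text \<open>The dual relation says \<langle>\<alpha>,Q\<xi>\<rangle> =
  \<langle>\<beta>,P\<xi>\<rangle> for all \<xi>. Antisymmetry moves \<xi> to the front on both
  sides, and since dual sections separate vectors, Q\<alpha> = P\<beta> follows.\<close>

lemma (in smooth_bundle) dual_pair_relation_sharp:
  assumes P: "P \<in> mv_sections A 2" and Q: "Q \<in> mv_sections A 2"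
    and dual: "(\<beta>, \<alpha>) \<in> dual_relation A (pair_relation A P Q)"
  shows "sharp A Q \<alpha> = sharp A P \<beta>"
    and "\<xi> \<in> dual_sections A \<Longrightarrow> pairing \<alpha> (sharp A Q \<xi>) = pairing \<beta> (sharp A P \<xi>)"
proof -
  have \<beta>: "\<beta> \<in> dual_sections A" and \<alpha>: "\<alpha> \<in> dual_sections A"
    using dual by (auto simp: dual_relation_def)
  show *: "pairing \<alpha> (sharp A Q \<xi>) = pairing \<beta> (sharp A P \<xi>)" if "\<xi> \<in> dual_sections A" for \<xi>
    using dual that by (auto simp: dual_relation_def pair_relation_def)
  show "sharp A Q \<alpha> = sharp A P \<beta>"
  proof
    fix x
    have "pairing \<xi> (sharp A Q \<alpha>) x = pairing \<xi> (sharp A P \<beta>) x" if "\<xi> \<in> dual_sections A" for \<xi>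
      using *[OF that] pairing_sharp_antisym[OF Q that \<alpha>] pairing_sharp_antisym[OF P that \<beta>] by simp
    then show "sharp A Q \<alpha> x = sharp A P \<beta> x"
      by (intro dual_space_separates[of _ x] sharp_in_fibre P Q \<alpha> \<beta>) (simp add: pairing_def)
  qed
qed

theorem corollary2p4:
  fixes A :: "('m::{t2_space,second_countable_topology}, 'e::real_inner, 'v::real_vector) algebroid"
    and S :: "('m, 'v) mvfield \<Rightarrow> ('m, 'v) mvfield \<Rightarrow> ('m, 'v) mvfield"
    and \<pi> \<pi>' :: "('m, 'v) mvfield"
  assumes "lie_algebroid A"
    and "schouten_bracket A S"
    and "hamiltonian_pair A S \<pi> \<pi>'"
  shows "nijenhuis_relation A (pair_relation A \<pi> \<pi>')"
proof -
  interpret schouten_algebroid A S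
    using assms(1,2) by unfold_locales
  have poisson: "poisson_structure A S \<pi>" "poisson_structure A S \<pi>'"
    using assms(3) by (simp_all add: hamiltonian_pair_def)
  then have P: "\<pi> \<in> mv_sections A 2" and P': "\<pi>' \<in> mv_sections A 2"
    by (simp_all add: poisson_structure_def)
  let ?N = "pair_relation A \<pi> \<pi>'"
  have "pairing \<alpha> (bracket A v1 v2) x - pairing \<alpha>' (\<lambda>y. bracket A v1 u2 y + bracket A u1 v2 y) x
      + pairing \<alpha>'' (bracket A u1 u2) x = 0"
    if uv1: "(u1, v1) \<in> ?N" and uv2: "(u2, v2) \<in> ?N"
      and dual: "(\<alpha>, \<alpha>') \<in> dual_relation A ?N" "(\<alpha>', \<alpha>'') \<in> dual_relation A ?N"
    for u1 v1 u2 v2 \<alpha> \<alpha>' \<alpha>'' x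
  proof -
    obtain \<xi> where \<xi>: "\<xi> \<in> dual_sections A" and uv1_eq: "u1 = sharp A \<pi>' \<xi>" "v1 = sharp A \<pi> \<xi>"
      using uv1 by (auto simp: pair_relation_def)
    obtain \<eta> where \<eta>: "\<eta> \<in> dual_sections A" and uv2_eq: "u2 = sharp A \<pi>' \<eta>" "v2 = sharp A \<pi> \<eta>"
      using uv2 by (auto simp: pair_relation_def)
    have \<alpha>: "\<alpha> \<in> dual_sections A" and \<alpha>': "\<alpha>' \<in> dual_sections A" and \<alpha>'': "\<alpha>'' \<in> dual_sections A"
      using dual by (auto simp: dual_relation_def)
    note sec = sharp_sections[OF P \<xi>] sharp_sections[OF P' \<xi>] sharp_sections[OF P \<eta>] sharp_sections[OF P' \<eta>]
    have split: "pairing \<alpha>' (\<lambda>y. bracket A v1 u2 y + bracket A u1 v2 y) x =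
        pairing \<alpha>' (bracket A v1 u2) x + pairing \<alpha>' (bracket A u1 v2) x"
      unfolding uv1_eq uv2_eq by (intro pairing_add \<alpha>' bracket_sections sec)
    note sharp_eq = dual_pair_relation_sharp(1)[OF P P' dual(1)] dual_pair_relation_sharp(1)[OF P P' dual(2)]
    note pairing_eq = dual_pair_relation_sharp(2)[OF P P' dual(1) \<eta>] dual_pair_relation_sharp(2)[OF P P' dual(2) \<eta>]
      dual_pair_relation_sharp(2)[OF P P' dual(1) \<xi>] dual_pair_relation_sharp(2)[OF P P' dual(2) \<xi>]
    \<comment> \<open>The signs are those of the torsion. After substitution all other terms cancel
      in pairs: for example \<langle>\<xi>,[\<pi>\<eta>,\<pi>\<alpha>]\<rangle> against
      \<langle>\<xi>,[\<pi>\<eta>,\<pi>'\<alpha>']\<rangle>, and the derivative of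
      \<langle>\<alpha>,\<pi>\<xi>\<rangle> along \<pi>\<eta> against that of
      \<langle>\<alpha>',\<pi>'\<xi>\<rangle>.\<close>
    have "sharp_jacobi A \<pi> \<pi> \<xi> \<eta> \<alpha> x
        - (sharp_jacobi A \<pi> \<pi>' \<xi> \<eta> \<alpha>' x + sharp_jacobi A \<pi>' \<pi> \<xi> \<eta> \<alpha>' x)
        + sharp_jacobi A \<pi>' \<pi>' \<xi> \<eta> \<alpha>'' x = 0"
      using poisson_sharp_jacobi[OF poisson(1) \<xi> \<eta> \<alpha>] poisson_sharp_jacobi[OF poisson(2) \<xi> \<eta> \<alpha>'']
        hamiltonian_pair_sharp_jacobi[OF assms(3) \<xi> \<eta> \<alpha>'] by simp
    then show ?thesis
      unfolding split unfolding uv1_eq uv2_eq sharp_jacobi_def sharp_eq pairing_eq by simp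
  qed
  moreover have "?N \<subseteq> sections A \<times> sections A"
    using sharp_sections[OF P] sharp_sections[OF P'] by (auto simp: pair_relation_def)
  ultimately show ?thesis
    unfolding nijenhuis_relation_def by blast
qed

end
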